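(* Let $n\ge 1$ and let $f$ be a regular positive $n$-free formal power series. Let $F$, given by complex coefficients $(c_{j,\alpha})_{1\le j\le n,\ \alpha\in\mathbb{F}_n^+}$, be a biholomorphic map of $\mathcal{D}_f$ such that $F(0)=0$. Then $F$ is linear, i.e. $c_{j,\alpha}=0$ for all $j\in\{1,\ldots,n\}$ and all $\alpha\in\mathbb{F}_n^+$ with $|\alpha|\ne 1$.
   Context: Let $\mathbb{F}_n^+$ be the free semigroup (monoid) on generators $g_1,\ldots,g_n$ with identity $g_0$; $|\alpha|$ is the length of the word $\alpha$ (with $|g_0|=0$). For $\alpha=g_{i_1}\cdots g_{i_k}$ and elements $X_1,\ldots,X_n$ of a unital ring, $X_\alpha=X_{i_1}\cdots X_{i_k}$, and $X_{g_0}=1$. An $n$-free formal power series is a formal power series $f=\sum_{\alpha\in\mathbb{F}_n^+}a_\alpha X_\alpha$ in $n$ noncommuting indeterminates. It is regular positive if the $a_\alpha$ are real, $a_{g_0}=0$, $a_{g_i}>0$ for $i=1,\ldots,n$, $a_\alpha\ge 0$ for all $\alpha$, and $\sup_{k\ge 1}\left|\sum_{|\alpha|=k}a_\alpha^2\right|^{1/k}<\infty$. For a Hilbert space $\mathcal{H}$, $\mathcal{D}_f(\mathcal{H})=\{(T_1,\ldots,T_n)\in\mathcal{B}(\mathcal{H})^n:\sum_\alpha a_\alpha T_\alpha T_\alpha^*\le 1\}$ (meaning that all finite partial sums are $\le 1$). Its interior is taken in the norm topology of $\mathcal{B}(\mathcal{H})^n$. A holomorphic map $F$ with domain and codomain $\mathcal{D}_f$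 is a family of complex coefficients $(c_{j,\alpha})_{1\le j\le n,\,\alpha\in\mathbb{F}_n^+}$ such that for every Hilbert space $\mathcal{H}$ the function $$F_{\mathcal{H}}:(T_1,\ldots,T_n)\in\mathrm{interior}\,\mathcal{D}_f(\mathcal{H})\longmapsto\left(\sum_{\alpha\in\mathbb{F}_n^+}c_{1,\alpha}T_\alpha,\ldots,\sum_{\alpha\in\mathbb{F}_n^+}c_{n,\alpha}T_\alpha\right)$$ is well defined (each series being understood as $\sum_{k\ge 0}\sum_{|\alpha|=k}c_{j,\alpha}T_\alpha$, convergent in operator norm) and has range contained in the interior of $\mathcal{D}_f(\mathcal{H})$. For $\mathcal{H}=\mathbb{C}^k$ the induced map on the interior of $\mathcal{D}_f(\mathbb{C}^k)$ is a holomorphic map in the usual sense. A biholomorphic map $F$ of $\mathcal{D}_f$ is a holomorphic map with domain and codomain $\mathcal{D}_f$ for which there is a holomorphic map $G$ with domain and codomain $\mathcal{D}_f$ such that $F_{\mathcal{H}}\circ G_{\mathcal{H}}$ and $G_{\mathcal{H}}\circ F_{\mathcal{H}}$ are the identity of the interior of $\mathcal{D}_f(\mathcal{H})$ for all Hilbert spaces $\mathcal{H}$. The condition $F(0)=0$ means $F_{\mathcal{H}}(0,\ldots,0)=(0,\ldots,0)$ for all $\mathcal{H}$. *)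

theory Defs
  imports "HOL-Analysis.Analysis" "HOL-Algebra.Algebraic_Closure_Type"
begin

section \<open>Complex Hilbert spaces\<close>

text \<open>
  The notion of a holomorphic map below quantifies over all Hilbert spaces. As a formula cannot
  quantify over types, a Hilbert space is a structure with an explicit carrier. The inner product
  is linear in its first argument.
\<close>

abbreviation complex_field :: "complex ring"
  where "complex_field \<equiv> ring_of_type_algebra"

record 'h hilbert = "(complex, 'h) module" +
  ip :: "'h \<Rightarrow> 'h \<Rightarrow> complex"

definition hnorm :: "('h, 'b) hilbert_scheme \<Rightarrow> 'h \<Rightarrow> real"
  where "hnorm H x = sqrt (Re (ip H x x))"

text \<open>
  The value outside the carrier only serves the locale \<^locale>\<open>Metric_space\<close>, whose distance
  function is symmetric and nonnegative on the whole type.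
\<close>
definition hdist :: "('h, 'b) hilbert_scheme \<Rightarrow> 'h \<Rightarrow> 'h \<Rightarrow> real"
  where "hdist H x y =
    (if x \<in> carrier H \<and> y \<in> carrier H then hnorm H (x \<ominus>\<^bsub>H\<^esub> y) else 0)"

locale complex_inner_product_space = module complex_field H
  for H :: "('h, 'b) hilbert_scheme" (structure) +
  assumes ip_add: "\<lbrakk>x \<in> carrier H; y \<in> carrier H; z \<in> carrier H\<rbrakk> \<Longrightarrow>
      ip H (x \<oplus> y) z = ip H x z + ip H y z"
    and ip_smult: "\<lbrakk>x \<in> carrier H; y \<in> carrier H\<rbrakk> \<Longrightarrow> ip H (c \<odot> x) y = c * ip H x y"
    and ip_cnj: "\<lbrakk>x \<in> carrier H; y \<in> carrier H\<rbrakk> \<Longrightarrow> ip H y x = cnj (ip H x y)"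
    and ip_pos: "\<lbrakk>x \<in> carrier H; x \<noteq> \<zero>\<rbrakk> \<Longrightarrow> Re (ip H x x) > 0"

locale hilbert_space = complex_inner_product_space +
  assumes complete: "Metric_space.mcomplete (carrier H) (hdist H)"


section \<open>Bounded operators\<close>

definition bounded_operators :: "('h, 'b) hilbert_scheme \<Rightarrow> ('h \<Rightarrow> 'h) set"
  where "bounded_operators H = {T \<in> carrier H \<rightarrow>\<^sub>E carrier H.
    (\<forall>x\<in>carrier H. \<forall>y\<in>carrier H. T (x \<oplus>\<^bsub>H\<^esub> y) = T x \<oplus>\<^bsub>H\<^esub> T y) \<and>
    (\<forall>c. \<forall>x\<in>carrier H. T (c \<odot>\<^bsub>H\<^esub> x) = c \<odot>\<^bsub>H\<^esub> T x) \<and>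
    (\<exists>K. \<forall>x\<in>carrier H. hnorm H (T x) \<le> K * hnorm H x)}"

definition op_algebra :: "('h, 'b) hilbert_scheme \<Rightarrow> (complex, 'h \<Rightarrow> 'h) module"
  where "op_algebra H =
    \<lparr> carrier = bounded_operators H,
      mult = compose (carrier H),
      one = (\<lambda>x\<in>carrier H. x),
      zero = (\<lambda>x\<in>carrier H. \<zero>\<^bsub>H\<^esub>),
      add = (\<lambda>S T. \<lambda>x\<in>carrier H. S x \<oplus>\<^bsub>H\<^esub> T x),
      smult = (\<lambda>c T. \<lambda>x\<in>carrier H. c \<odot>\<^bsub>H\<^esub> T x) \<rparr>"

definition opnorm :: "('h, 'b) hilbert_scheme \<Rightarrow> ('h \<Rightarrow> 'h) \<Rightarrow> real"
  where "opnorm H T = (SUP x\<in>{x \<in> carrier H. hnorm H x \<le> 1}. hnorm H (T x))"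

definition opdist :: "('h, 'b) hilbert_scheme \<Rightarrow> ('h \<Rightarrow> 'h) \<Rightarrow> ('h \<Rightarrow> 'h) \<Rightarrow> real"
  where "opdist H S T =
    (if S \<in> bounded_operators H \<and> T \<in> bounded_operators H
     then opnorm H (S \<ominus>\<^bsub>op_algebra H\<^esub> T) else 0)"

definition op_topology :: "('h, 'b) hilbert_scheme \<Rightarrow> ('h \<Rightarrow> 'h) topology"
  where "op_topology H = Metric_space.mtopology (bounded_operators H) (opdist H)"

definition adjoint :: "('h, 'b) hilbert_scheme \<Rightarrow> ('h \<Rightarrow> 'h) \<Rightarrow> ('h \<Rightarrow> 'h)"
  where "adjoint H T = (\<lambda>y\<in>carrier H.
    THE z. z \<in> carrier H \<and> (\<forall>x\<in>carrier H. ip H (T x) y = ip H x z))"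

definition op_le :: "('h, 'b) hilbert_scheme \<Rightarrow> ('h \<Rightarrow> 'h) \<Rightarrow> ('h \<Rightarrow> 'h) \<Rightarrow> bool"
  where "op_le H S T \<longleftrightarrow> (\<forall>x\<in>carrier H. ip H ((T \<ominus>\<^bsub>op_algebra H\<^esub> S) x) x \<in> \<real>\<^sub>\<ge>\<^sub>0)"


section \<open>Free formal power series and their domains\<close>

text \<open>
  The generators are indexed by a finite type \<open>'n\<close>, so that the free monoid on them is the type
  \<open>'n list\<close>; a formal power series is the family of its coefficients.
\<close>

definition word_eval :: "('r, 'm) ring_scheme \<Rightarrow> ('n \<Rightarrow> 'r) \<Rightarrow> 'n list \<Rightarrow> 'r"
  where "word_eval R Z \<alpha> = foldr (\<lambda>i W. Z i \<otimes>\<^bsub>R\<^esub> W) \<alpha> \<one>\<^bsub>R\<^esub>"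

definition regular_positive :: "('n::finite list \<Rightarrow> real) \<Rightarrow> bool"
  where "regular_positive a \<longleftrightarrow>
    a [] = 0 \<and> (\<forall>i. a [i] > 0) \<and> (\<forall>\<alpha>. a \<alpha> \<ge> 0) \<and>
    bdd_above ((\<lambda>k. root k \<bar>\<Sum>\<alpha> | length \<alpha> = k. (a \<alpha>)\<^sup>2\<bar>) ` {1..})"

definition free_domain ::
    "('n::finite list \<Rightarrow> real) \<Rightarrow> ('h, 'b) hilbert_scheme \<Rightarrow> ('n \<Rightarrow> 'h \<Rightarrow> 'h) set"
  where "free_domain a H = {T. (\<forall>j. T j \<in> bounded_operators H) \<and>
    (\<forall>A. finite A \<longrightarrow>
      op_le H
        (\<Oplus>\<^bsub>op_algebra H\<^esub>\<alpha>\<in>A. complex_of_real (a \<alpha>) \<odot>\<^bsub>op_algebra H\<^esub>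
          (word_eval (op_algebra H) T \<alpha> \<otimes>\<^bsub>op_algebra H\<^esub>
            adjoint H (word_eval (op_algebra H) T \<alpha>)))
        \<one>\<^bsub>op_algebra H\<^esub>)}"

text \<open>The product topology on \<open>n\<close>-tuples is the norm topology, as \<open>n\<close> is finite.\<close>
definition free_domain_interior ::
    "('n::finite list \<Rightarrow> real) \<Rightarrow> ('h, 'b) hilbert_scheme \<Rightarrow> ('n \<Rightarrow> 'h \<Rightarrow> 'h) set"
  where "free_domain_interior a H =
    (product_topology (\<lambda>_. op_topology H) UNIV) interior_of (free_domain a H)"


section \<open>Holomorphic maps\<close>

definition series_sums :: "('h, 'b) hilbert_scheme \<Rightarrow> ('n::finite list \<Rightarrow> complex) \<Rightarrow>
    ('n \<Rightarrow> 'h \<Rightarrow> 'h) \<Rightarrow> ('h \<Rightarrow> 'h) \<Rightarrow> bool"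
  where "series_sums H c T S \<longleftrightarrow>
    limitin (op_topology H)
      (\<lambda>N. \<Oplus>\<^bsub>op_algebra H\<^esub>k\<in>{..<N}. \<Oplus>\<^bsub>op_algebra H\<^esub>\<alpha>\<in>{\<alpha>. length \<alpha> = k}.
         c \<alpha> \<odot>\<^bsub>op_algebra H\<^esub> word_eval (op_algebra H) T \<alpha>)
      S sequentially"

definition induced_map :: "('n::finite \<Rightarrow> 'n list \<Rightarrow> complex) \<Rightarrow> ('h, 'b) hilbert_scheme \<Rightarrow>
    ('n \<Rightarrow> 'h \<Rightarrow> 'h) \<Rightarrow> ('n \<Rightarrow> 'h \<Rightarrow> 'h)"
  where "induced_map c H T = (\<lambda>j. THE S. series_sums H (c j) T S)"

text \<open>
  The Hilbert spaces considered are those whose underlying set is a set of elements of the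
  type \<open>'h\<close>, which acts as a universe. If it has at least continuum many elements, it contains an
  isomorphic copy of every separable Hilbert space, in particular of all the spaces
  \<open>\<complex>\<^sup>k\<close>; on too small a type, the quantification over Hilbert spaces would be void of content.
\<close>
definition holomorphic_map :: "'h itself \<Rightarrow> ('n::finite list \<Rightarrow> real) \<Rightarrow>
    ('n \<Rightarrow> 'n list \<Rightarrow> complex) \<Rightarrow> bool"
  where "holomorphic_map _ a c \<longleftrightarrow>
    (\<forall>H :: 'h hilbert. hilbert_space H \<longrightarrow>
      (\<forall>T\<in>free_domain_interior a H.
        (\<forall>j. \<exists>S. series_sums H (c j) T S) \<and>
        induced_map c H T \<in> free_domain_interior a H))"

definition biholomorphic_map :: "'h itself \<Rightarrow> ('n::finite list \<Rightarrow> real) \<Rightarrow>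
    ('n \<Rightarrow> 'n list \<Rightarrow> complex) \<Rightarrow> bool"
  where "biholomorphic_map U a c \<longleftrightarrow>
    holomorphic_map U a c \<and>
    (\<exists>d. holomorphic_map U a d \<and>
      (\<forall>H :: 'h hilbert. hilbert_space H \<longrightarrow>
        (\<forall>T\<in>free_domain_interior a H.
          induced_map c H (induced_map d H T) = T \<and>
          induced_map d H (induced_map c H T) = T)))"

definition maps_zero_to_zero :: "'h itself \<Rightarrow> ('n::finite \<Rightarrow> 'n list \<Rightarrow> complex) \<Rightarrow> bool"
  where "maps_zero_to_zero _ c \<longleftrightarrow>
    (\<forall>H :: 'h hilbert. hilbert_space H \<longrightarrow>
      induced_map c H (\<lambda>_. \<zero>\<^bsub>op_algebra H\<^esub>) = (\<lambda>_. \<zero>\<^bsub>op_algebra H\<^esub>))"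


section \<open>Well-definedness of the structures involved\<close>

text \<open>
  The norm topologies come from genuine metrics (\<open>Metric_space_hdist\<close>, \<open>Metric_space_opdist\<close>),
  the bounded operators form a ring and a complex vector space (\<open>op_ring\<close>, \<open>op_module\<close>), and the
  definite description in \<^const>\<open>induced_map\<close> is unambiguous (\<open>series_sums_unique\<close>).
\<close>

lemma complex_field_simps [simp]:
  "carrier (ring_of_type_algebra :: complex ring) = UNIV"
  "x \<otimes>\<^bsub>ring_of_type_algebra\<^esub> y = x * (y :: complex)"
  "x \<oplus>\<^bsub>ring_of_type_algebra\<^esub> y = x + (y :: complex)"
  "\<one>\<^bsub>ring_of_type_algebra\<^esub> = (1 :: complex)"
  "\<zero>\<^bsub>ring_of_type_algebra\<^esub> = (0 :: complex)"
  by (simp_all add: ring_of_type_algebra_def)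

context complex_inner_product_space
begin

lemma ip_zero_left: "y \<in> carrier H \<Longrightarrow> ip H \<zero> y = 0"
  using ip_add[of \<zero> \<zero> y] by simp

lemma ip_zero_right: "y \<in> carrier H \<Longrightarrow> ip H y \<zero> = 0"
  using ip_cnj[of \<zero> y] ip_zero_left[of y] by simp

lemma ip_add_right: "\<lbrakk>x \<in> carrier H; y \<in> carrier H; z \<in> carrier H\<rbrakk> \<Longrightarrow>
      ip H z (x \<oplus> y) = ip H z x + ip H z y"
  by (metis M.add.m_closed complex_cnj_add ip_add ip_cnj)

lemma ip_smult_right: "\<lbrakk>x \<in> carrier H; y \<in> carrier H\<rbrakk> \<Longrightarrow> ip H y (c \<odot> x) = cnj c * ip H y x"
  by (metis UNIV_I complex_cnj_mult complex_field_simps(1) ip_cnj ip_smult smult_closed)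

lemma ip_self: "x \<in> carrier H \<Longrightarrow> ip H x x = of_real (Re (ip H x x))"
  using ip_cnj[of x x] by (metis complex_In_mult_cnj_zero Reals_cnj_iff of_real_Re)

lemma ip_self_nonneg: "x \<in> carrier H \<Longrightarrow> 0 \<le> Re (ip H x x)"
  using ip_pos[of x] ip_zero_left[of \<zero>] by (cases "x = \<zero>") auto

lemma hnorm_nonneg: "x \<in> carrier H \<Longrightarrow> 0 \<le> hnorm H x"
  by (simp add: hnorm_def ip_self_nonneg)

lemma hnorm_eq_0: "x \<in> carrier H \<Longrightarrow> hnorm H x = 0 \<longleftrightarrow> x = \<zero>"
  using ip_pos[of x] ip_zero_left[of \<zero>] by (cases "x = \<zero>") (auto simp: hnorm_def)

lemma hnorm_sq: "x \<in> carrier H \<Longrightarrow> (hnorm H x)\<^sup>2 = Re (ip H x x)"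
  by (simp add: hnorm_def ip_self_nonneg)

lemma hnorm_smult: "x \<in> carrier H \<Longrightarrow> hnorm H (c \<odot> x) = cmod c * hnorm H x"
proof -
  assume x: "x \<in> carrier H"
  have "ip H (c \<odot> x) (c \<odot> x) = (c * cnj c) * ip H x x"
    using x by (simp add: ip_smult ip_smult_right)
  also have "\<dots> = of_real ((cmod c)\<^sup>2 * Re (ip H x x))"
    using ip_self[OF x] by (metis complex_norm_square of_real_mult)
  finally show ?thesis by (simp add: hnorm_def real_sqrt_mult)
qed

lemma Cauchy_Schwarz:
  assumes x: "x \<in> carrier H" and y: "y \<in> carrier H"
  shows "cmod (ip H x y) \<le> hnorm H x * hnorm H y"
proof (cases "y = \<zero>")
  case True
  then show ?thesis using x y by (simp add: ip_zero_right hnorm_nonneg)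
next
  case False
  define s where "s = Re (ip H y y)"
  have s: "s > 0" "ip H y y = of_real s" using ip_pos[OF y False] ip_self[OF y] by (auto simp: s_def)
  define t where "t = - (ip H x y / of_real s)"
  have [simp]: "t \<odot> y \<in> carrier H" using y by simp
  have "ip H (x \<oplus> t \<odot> y) (x \<oplus> t \<odot> y)
     = ip H x x + cnj t * ip H x y + t * ip H y x + t * cnj t * ip H y y"
    using x y by (simp add: ip_add ip_add_right ip_smult ip_smult_right algebra_simps)
  also have "\<dots> = ip H x x - ip H x y * cnj (ip H x y) / of_real s"
    using s by (simp add: t_def ip_cnj[OF x y] field_simps)
  also have "\<dots> = ip H x x - of_real ((cmod (ip H x y))\<^sup>2 / s)"
    by (simp add: complex_norm_square[symmetric])
  finally have "0 \<le> Re (ip H x x) - (cmod (ip H x y))\<^sup>2 / s"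
    using ip_self_nonneg[of "x \<oplus> t \<odot> y"] x by simp
  then have "(cmod (ip H x y))\<^sup>2 \<le> Re (ip H x x) * s"
    using s by (simp add: field_simps)
  also have "\<dots> = (hnorm H x * hnorm H y)\<^sup>2"
    using x y by (simp add: power_mult_distrib hnorm_sq s_def)
  finally show ?thesis
    by (rule power2_le_imp_le) (simp add: x y hnorm_nonneg)
qed

lemma hnorm_add:
  assumes x: "x \<in> carrier H" and y: "y \<in> carrier H"
  shows "hnorm H (x \<oplus> y) \<le> hnorm H x + hnorm H y"
proof -
  have "(hnorm H (x \<oplus> y))\<^sup>2 = Re (ip H x x) + Re (ip H x y) + Re (ip H y x) + Re (ip H y y)"
    using x y by (simp add: hnorm_sq ip_add ip_add_right)
  also have "\<dots> = (hnorm H x)\<^sup>2 + 2 * Re (ip H x y) + (hnorm H y)\<^sup>2"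
    using x y by (simp add: hnorm_sq ip_cnj[OF x y])
  also have "\<dots> \<le> (hnorm H x)\<^sup>2 + 2 * (hnorm H x * hnorm H y) + (hnorm H y)\<^sup>2"
    using Cauchy_Schwarz[OF x y] complex_Re_le_cmod[of "ip H x y"] by linarith
  also have "\<dots> = (hnorm H x + hnorm H y)\<^sup>2" by (simp add: power2_eq_square algebra_simps)
  finally show ?thesis
    by (rule power2_le_imp_le) (simp add: x y hnorm_nonneg)
qed

lemma minus_eq_smult: "x \<in> carrier H \<Longrightarrow> \<ominus> x = (-1) \<odot> x"
proof -
  assume x: "x \<in> carrier H"
  have z: "0 \<odot> x = \<zero>"
    using smult_l_distr[of 0 0 x] x by simp
  have "((-1) \<odot> x) \<oplus> x = ((-1) + 1) \<odot> x"
    using smult_l_distr[of "-1" 1 x] smult_one[OF x] x by simp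
  then have "((-1) \<odot> x) \<oplus> x = \<zero>" by (simp add: z)
  then show ?thesis using x by (intro M.minus_equality) auto
qed

lemma hnorm_minus: "x \<in> carrier H \<Longrightarrow> hnorm H (\<ominus> x) = hnorm H x"
  by (simp add: minus_eq_smult hnorm_smult)

lemma M_minus_eq: "\<lbrakk>x \<in> carrier H; y \<in> carrier H\<rbrakk> \<Longrightarrow> x \<ominus> y = \<zero> \<longleftrightarrow> x = y"
  by (metis M.add.inv_closed M.l_neg M.minus_equality M.minus_minus M.r_neg a_minus_def)

lemma Metric_space_hdist: "Metric_space (carrier H) (hdist H)"
proof
  fix x y show "0 \<le> hdist H x y" by (simp add: hdist_def hnorm_nonneg)
next
  fix x y
  have "hnorm H (x \<ominus> y) = hnorm H (y \<ominus> x)" if "x \<in> carrier H" "y \<in> carrier H"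
    using hnorm_minus[of "x \<ominus> y"] that by (simp add: a_minus_def M.minus_add M.a_comm)
  then show "hdist H x y = hdist H y x" by (simp add: hdist_def)
next
  fix x y assume "x \<in> carrier H" "y \<in> carrier H"
  then show "hdist H x y = 0 \<longleftrightarrow> x = y" by (simp add: hdist_def hnorm_eq_0 M_minus_eq)
next
  fix x y z assume xyz: "x \<in> carrier H" "y \<in> carrier H" "z \<in> carrier H"
  then have "x \<ominus> z = (x \<ominus> y) \<oplus> (y \<ominus> z)"
    by (simp add: a_minus_def M.a_assoc M.r_neg1 M.r_neg2)
  then show "hdist H x z \<le> hdist H x y + hdist H y z"
    using xyz hnorm_add[of "x \<ominus> y" "y \<ominus> z"] by (simp add: hdist_def)
qed

lemma op_closed: "\<lbrakk>T \<in> bounded_operators H; x \<in> carrier H\<rbrakk> \<Longrightarrow> T x \<in> carrier H"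
  by (auto simp: bounded_operators_def)

lemma op_eqI: "\<lbrakk>S \<in> bounded_operators H; T \<in> bounded_operators H;
   \<And>x. x \<in> carrier H \<Longrightarrow> S x = T x\<rbrakk> \<Longrightarrow> S = T"
  by (auto simp: bounded_operators_def intro: PiE_ext)

lemma op_bound:
  assumes "T \<in> bounded_operators H"
  obtains K where "K \<ge> 0" "\<And>x. x \<in> carrier H \<Longrightarrow> hnorm H (T x) \<le> K * hnorm H x"
proof -
  obtain K where K: "\<forall>x\<in>carrier H. hnorm H (T x) \<le> K * hnorm H x"
    using assms by (auto simp: bounded_operators_def)
  have "hnorm H (T x) \<le> max K 0 * hnorm H x" if "x \<in> carrier H" for x
    using K that hnorm_nonneg[OF that] by (meson max.cobounded1 mult_right_mono order_trans)
  then show ?thesis using that[of "max K 0"] by auto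
qed

lemma add_op:
  assumes S: "S \<in> bounded_operators H" and T: "T \<in> bounded_operators H"
  shows "(\<lambda>x\<in>carrier H. S x \<oplus> T x) \<in> bounded_operators H"
proof -
  obtain K L where K: "\<And>x. x \<in> carrier H \<Longrightarrow> hnorm H (S x) \<le> K * hnorm H x"
     and L: "\<And>x. x \<in> carrier H \<Longrightarrow> hnorm H (T x) \<le> L * hnorm H x"
    using op_bound S T by metis
  have "hnorm H (S x \<oplus> T x) \<le> (K + L) * hnorm H x" if "x \<in> carrier H" for x
    using K[OF that] L[OF that] hnorm_add[OF op_closed[OF S that] op_closed[OF T that]]
    by (simp add: algebra_simps)
  then have "\<exists>K. \<forall>x\<in>carrier H. hnorm H ((\<lambda>x\<in>carrier H. S x \<oplus> T x) x) \<le> K * hnorm H x"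
    by auto
  moreover have "(S (x \<oplus> y) \<oplus> T (x \<oplus> y)) = (S x \<oplus> T x) \<oplus> (S y \<oplus> T y)"
    if "x \<in> carrier H" "y \<in> carrier H" for x y
    using that op_closed[OF S] op_closed[OF T] S T
    by (simp add: bounded_operators_def M.a_ac)
  moreover have "S (c \<odot> x) \<oplus> T (c \<odot> x) = c \<odot> (S x \<oplus> T x)" if "x \<in> carrier H" for x c
    using that op_closed[OF S] op_closed[OF T] S T
    by (simp add: bounded_operators_def smult_r_distr)
  ultimately show ?thesis
    unfolding bounded_operators_def using op_closed[OF S] op_closed[OF T]
    by (auto simp: restrict_PiE_iff)
qed

lemma smult_op:
  assumes S: "S \<in> bounded_operators H"
  shows "(\<lambda>x\<in>carrier H. c \<odot> S x) \<in> bounded_operators H"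
proof -
  obtain K where K: "\<And>x. x \<in> carrier H \<Longrightarrow> hnorm H (S x) \<le> K * hnorm H x"
    using op_bound S by metis
  have "hnorm H (c \<odot> S x) \<le> (cmod c * K) * hnorm H x" if "x \<in> carrier H" for x
    using K[OF that] op_closed[OF S that] by (simp add: hnorm_smult mult.assoc mult_left_mono)
  then have "\<exists>K. \<forall>x\<in>carrier H. hnorm H ((\<lambda>x\<in>carrier H. c \<odot> S x) x) \<le> K * hnorm H x"
    by auto
  moreover have "c \<odot> S (d \<odot> x) = d \<odot> (c \<odot> S x)" if "x \<in> carrier H" for x d
    using that op_closed[OF S] S smult_assoc1[of c d "S x"] smult_assoc1[of d c "S x"]
    by (simp add: bounded_operators_def mult.commute)
  moreover have "c \<odot> S (x \<oplus> y) = c \<odot> S x \<oplus> c \<odot> S y" if "x \<in> carrier H" "y \<in> carrier H" for x y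
    using that op_closed[OF S] S by (simp add: bounded_operators_def smult_r_distr)
  ultimately show ?thesis
    unfolding bounded_operators_def using op_closed[OF S] by (auto simp: restrict_PiE_iff)
qed

lemma comp_op:
  assumes S: "S \<in> bounded_operators H" and T: "T \<in> bounded_operators H"
  shows "compose (carrier H) S T \<in> bounded_operators H"
proof -
  obtain K L where K: "K \<ge> 0" "\<And>x. x \<in> carrier H \<Longrightarrow> hnorm H (S x) \<le> K * hnorm H x"
     and L: "\<And>x. x \<in> carrier H \<Longrightarrow> hnorm H (T x) \<le> L * hnorm H x"
    using op_bound S T by metis
  have "hnorm H (S (T x)) \<le> (K * L) * hnorm H x" if "x \<in> carrier H" for x
    using K(2)[OF op_closed[OF T that]] mult_left_mono[OF L[OF that] K(1)] by simp
  then have "\<exists>K. \<forall>x\<in>carrier H. hnorm H (compose (carrier H) S T x) \<le> K * hnorm H x"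
    by (auto simp: compose_eq)
  then show ?thesis
    unfolding bounded_operators_def using op_closed[OF S] op_closed[OF T] S T
    by (auto simp: compose_def restrict_PiE_iff bounded_operators_def)
qed

lemma one_op: "(\<lambda>x\<in>carrier H. x) \<in> bounded_operators H"
  unfolding bounded_operators_def
  by (auto simp: restrict_PiE_iff intro!: exI[of _ 1])

lemma zero_op: "(\<lambda>x\<in>carrier H. \<zero>) \<in> bounded_operators H"
proof -
  have "c \<odot> \<zero> = \<zero>" for c using hnorm_smult[of \<zero> c] hnorm_eq_0[of \<zero>] hnorm_eq_0[of "c \<odot> \<zero>"] by simp
  then show ?thesis unfolding bounded_operators_def using hnorm_eq_0[of \<zero>]
  by (auto simp: restrict_PiE_iff intro!: exI[of _ 0])
qed

lemma op_simps:
  "carrier (op_algebra H) = bounded_operators H"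
  "S \<otimes>\<^bsub>op_algebra H\<^esub> T = compose (carrier H) S T"
  "\<one>\<^bsub>op_algebra H\<^esub> = (\<lambda>x\<in>carrier H. x)"
  "\<zero>\<^bsub>op_algebra H\<^esub> = (\<lambda>x\<in>carrier H. \<zero>)"
  "S \<oplus>\<^bsub>op_algebra H\<^esub> T = (\<lambda>x\<in>carrier H. S x \<oplus> T x)"
  "c \<odot>\<^bsub>op_algebra H\<^esub> T = (\<lambda>x\<in>carrier H. c \<odot> T x)"
  by (simp_all add: op_algebra_def)

lemma op_add: "\<lbrakk>T \<in> bounded_operators H; x \<in> carrier H; y \<in> carrier H\<rbrakk> \<Longrightarrow> T (x \<oplus> y) = T x \<oplus> T y"
  by (auto simp: bounded_operators_def)

lemma op_smult: "\<lbrakk>T \<in> bounded_operators H; x \<in> carrier H\<rbrakk> \<Longrightarrow> T (c \<odot> x) = c \<odot> T x"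
  by (auto simp: bounded_operators_def)

lemmas op_intros = add_op smult_op comp_op one_op zero_op

lemma op_abelian_group: "abelian_group (op_algebra H)"
proof (rule abelian_groupI, unfold op_simps)
  fix S assume S: "S \<in> bounded_operators H"
  show "\<exists>T\<in>bounded_operators H. (\<lambda>x\<in>carrier H. T x \<oplus> S x) = (\<lambda>x\<in>carrier H. \<zero>)"
  proof (rule bexI[OF _ smult_op[OF S, of "-1"]], rule restrict_ext)
    fix x assume "x \<in> carrier H"
    then show "(\<lambda>x\<in>carrier H. (-1) \<odot> S x) x \<oplus> S x = \<zero>"
      using op_closed[OF S, of x] by (simp add: minus_eq_smult[symmetric] M.l_neg)
  qed
qed (rule op_eqI; (intro op_intros)?; simp add: op_closed M.a_ac op_intros; fail | intro op_intros; assumption)+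

lemma op_ring: "ring (op_algebra H)"
proof (rule ringI)
  show "abelian_group (op_algebra H)" by (rule op_abelian_group)
  show "Group.monoid (op_algebra H)"
    by (rule monoidI; unfold op_simps)
       (rule op_eqI; (intro op_intros)?; simp add: op_closed compose_eq op_intros; fail | intro op_intros; assumption?)+
qed (unfold op_simps, (rule op_eqI; (intro op_intros)?; simp add: op_closed compose_eq op_add op_intros)+)

lemma op_module: "module complex_field (op_algebra H)"
  by (rule moduleI[OF cring_from_type_algebra op_abelian_group]; unfold op_simps)
    (rule op_eqI; (intro op_intros)?; simp add: op_closed op_intros smult_l_distr[simplified] smult_r_distr[simplified] smult_assoc1[simplified] smult_one[simplified]; fail | intro op_intros; assumption)+

sublocale op: ring "op_algebra H" by (rule op_ring)

lemma op_minus: "\<lbrakk>S \<in> bounded_operators H; T \<in> bounded_operators H; x \<in> carrier H\<rbrakk> \<Longrightarrow>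
   (S \<ominus>\<^bsub>op_algebra H\<^esub> T) x = S x \<ominus> T x"
proof -
  assume S: "S \<in> bounded_operators H" and T: "T \<in> bounded_operators H" and x: "x \<in> carrier H"
  have T': "\<ominus>\<^bsub>op_algebra H\<^esub> T \<in> bounded_operators H" using op.a_inv_closed T by (simp add: op_simps)
  have "T \<oplus>\<^bsub>op_algebra H\<^esub> (\<ominus>\<^bsub>op_algebra H\<^esub> T) = \<zero>\<^bsub>op_algebra H\<^esub>"
    using T op.r_neg by (simp add: op_simps)
  from fun_cong[OF this, of x] have "T x \<oplus> (\<ominus>\<^bsub>op_algebra H\<^esub> T) x = \<zero>"
    using x by (simp add: op_simps)
  then have "(\<ominus>\<^bsub>op_algebra H\<^esub> T) x = \<ominus> T x"
    using op_closed[OF T x] op_closed[OF T' x] M.minus_equality M.a_comm by metis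
  then show ?thesis using x by (simp add: a_minus_def op_simps)
qed

lemma opnorm_bound:
  assumes T: "T \<in> bounded_operators H" and x: "x \<in> carrier H" "hnorm H x \<le> 1"
  shows "hnorm H (T x) \<le> opnorm H T"
proof -
  obtain K where K: "K \<ge> 0" "\<And>x. x \<in> carrier H \<Longrightarrow> hnorm H (T x) \<le> K * hnorm H x"
    using op_bound[OF T] by metis
  have "bdd_above ((\<lambda>x. hnorm H (T x)) ` {x \<in> carrier H. hnorm H x \<le> 1})"
  proof (rule bdd_aboveI2)
    fix y assume y: "y \<in> {x \<in> carrier H. hnorm H x \<le> 1}"
    then have "hnorm H (T y) \<le> K * hnorm H y" using K by auto
    also have "\<dots> \<le> K" using y K by (simp add: mult_left_le)
    finally show "hnorm H (T y) \<le> K" .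
  qed
  then show ?thesis unfolding opnorm_def by (rule cSUP_upper[rotated]) (use x in auto)
qed

lemma opnorm_le:
  assumes "\<And>x. \<lbrakk>x \<in> carrier H; hnorm H x \<le> 1\<rbrakk> \<Longrightarrow> hnorm H (T x) \<le> K"
  shows "opnorm H T \<le> K"
proof -
  have "\<zero> \<in> {x \<in> carrier H. hnorm H x \<le> 1}" using hnorm_eq_0[of \<zero>] by auto
  then show ?thesis unfolding opnorm_def by (intro cSUP_least) (use assms in auto)
qed

lemma opnorm_nonneg: "T \<in> bounded_operators H \<Longrightarrow> 0 \<le> opnorm H T"
  using opnorm_bound[of T \<zero>] hnorm_nonneg[OF op_closed[of T \<zero>]] hnorm_eq_0[of \<zero>] by simp

lemma opnorm_eq_0: 
  assumes T: "T \<in> bounded_operators H" and 0: "opnorm H T = 0" and x: "x \<in> carrier H"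
  shows "T x = \<zero>"
proof (cases "x = \<zero>")
  case True
  have "hnorm H (T x) \<le> 0" using opnorm_bound[OF T x] 0 True hnorm_eq_0[of \<zero>] by simp
  then show ?thesis using hnorm_nonneg[OF op_closed[OF T x]] hnorm_eq_0[OF op_closed[OF T x]] by simp
next
  case False
  then have n: "hnorm H x > 0" using hnorm_eq_0[OF x] hnorm_nonneg[OF x] by simp
  define c where "c = complex_of_real (1 / hnorm H x)"
  have "hnorm H (c \<odot> x) = 1" using n x by (simp add: hnorm_smult c_def norm_divide)
  then have "hnorm H (c \<odot> T x) \<le> 0" using opnorm_bound[OF T, of "c \<odot> x"] x 0 op_smult[OF T x] by simp
  then have "hnorm H (T x) \<le> 0" using n op_closed[OF T x] by (simp add: hnorm_smult c_def norm_divide divide_le_0_iff)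
  then show ?thesis using hnorm_nonneg[OF op_closed[OF T x]] hnorm_eq_0[OF op_closed[OF T x]] by simp
qed

lemma Metric_space_opdist: "Metric_space (bounded_operators H) (opdist H)"
proof
  have cl: "S \<ominus>\<^bsub>op_algebra H\<^esub> T \<in> bounded_operators H" if "S \<in> bounded_operators H" "T \<in> bounded_operators H" for S T
    using op.minus_closed that by (simp add: op_simps)
  fix S T show "0 \<le> opdist H S T" by (simp add: opdist_def opnorm_nonneg cl)
  have le: "opnorm H (S \<ominus>\<^bsub>op_algebra H\<^esub> T) \<le> opnorm H (T \<ominus>\<^bsub>op_algebra H\<^esub> S)"
    if S: "S \<in> bounded_operators H" and T: "T \<in> bounded_operators H" for S T
  proof (rule opnorm_le)
    fix x assume x: "x \<in> carrier H" "hnorm H x \<le> 1"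
    have "hdist H (S x) (T x) = hdist H (T x) (S x)"
      using Metric_space.commute[OF Metric_space_hdist] .
    then show "hnorm H ((S \<ominus>\<^bsub>op_algebra H\<^esub> T) x) \<le> opnorm H (T \<ominus>\<^bsub>op_algebra H\<^esub> S)"
      using opnorm_bound[OF cl[OF T S] x] op_minus[OF S T x(1)] op_minus[OF T S x(1)] op_closed S T x
      by (simp add: hdist_def)
  qed
  show "opdist H S T = opdist H T S" using le[of S T] le[of T S] by (auto simp: opdist_def)
  { fix U assume S: "S \<in> bounded_operators H" and T: "T \<in> bounded_operators H" and U: "U \<in> bounded_operators H"
    have "opnorm H (S \<ominus>\<^bsub>op_algebra H\<^esub> U) \<le> opnorm H (S \<ominus>\<^bsub>op_algebra H\<^esub> T) + opnorm H (T \<ominus>\<^bsub>op_algebra H\<^esub> U)"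
    proof (rule opnorm_le)
      fix x assume x: "x \<in> carrier H" "hnorm H x \<le> 1"
      have "hdist H (S x) (U x) \<le> hdist H (S x) (T x) + hdist H (T x) (U x)"
        using Metric_space.triangle[OF Metric_space_hdist] op_closed S T U x by simp
      then show "hnorm H ((S \<ominus>\<^bsub>op_algebra H\<^esub> U) x) \<le> opnorm H (S \<ominus>\<^bsub>op_algebra H\<^esub> T) + opnorm H (T \<ominus>\<^bsub>op_algebra H\<^esub> U)"
        using opnorm_bound[OF cl[OF T U] x] opnorm_bound[OF cl[OF S T] x] op_minus[OF S T x(1)] op_minus[OF T U x(1)] op_minus[OF S U x(1)] op_closed S T U x
        by (simp add: hdist_def)
    qed
    then show "opdist H S U \<le> opdist H S T + opdist H T U" using S T U by (simp add: opdist_def) }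
  assume S: "S \<in> bounded_operators H" and T: "T \<in> bounded_operators H"
  show "opdist H S T = 0 \<longleftrightarrow> S = T"
  proof
    assume "opdist H S T = 0"
    then have "opnorm H (S \<ominus>\<^bsub>op_algebra H\<^esub> T) = 0" using S T by (simp add: opdist_def)
    then have "S x = T x" if "x \<in> carrier H" for x
      using opnorm_eq_0[OF cl[OF S T] _ that] op_minus[OF S T that] op_closed S T that M_minus_eq by auto
    then show "S = T" using op_eqI[OF S T] by blast
  next
    assume "S = T"
    have "(S \<ominus>\<^bsub>op_algebra H\<^esub> S) x = \<zero>" if "x \<in> carrier H" for x
      using op_minus[OF S S that] op_closed[OF S that] M_minus_eq by simp
    then have "opnorm H (S \<ominus>\<^bsub>op_algebra H\<^esub> S) \<le> 0" by (intro opnorm_le) (use hnorm_eq_0[of \<zero>] in auto)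
    then show "opdist H S T = 0" using opnorm_nonneg[OF cl[OF S S]] \<open>S = T\<close> by (simp add: opdist_def)
  qed
qed

lemma series_sums_unique:
  assumes "series_sums H c T S" "series_sums H c T S'" shows "S = S'"
proof -
  interpret op_ms: Metric_space "bounded_operators H" "opdist H" by (rule Metric_space_opdist)
  show ?thesis using assms unfolding series_sums_def op_topology_def
    by (rule op_ms.limitin_metric_unique) simp
qed

end
end

theory Submission
  imports Defs
begin

text \<open>
  The argument is H. Cartan's: an automorphism of a bounded circular domain that fixes the origin
  is linear, because otherwise a rotated copy of it, composed with its inverse, has iterates whose
  Taylor coefficients grow without bound. All of it can be carried out on finite-dimensional
  Hilbert spaces where no series has to be summed.

  The space is the truncated Fock space with one orthonormal basis vector per word of length at
  most \<open>m\<close>. Call an operator raising if it strictly increases the degree of vectors. A product of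
  more than \<open>m\<close> raising operators vanishes, so at a tuple of raising operators a power series is a
  finite sum (\<open>induced_map_nilpotent\<close>). The creation operators, scaled by a small \<open>r > 0\<close>, are
  raising and lie in the interior of the domain (\<open>small_in_free_domain_interior\<close>, which is where
  the growth condition on the coefficients \<open>a\<close> enters). They separate the words of length at most
  \<open>m\<close>: evaluated on the vacuum vector they return \<open>r\<close> to the length of the word times the
  basis vector of that word (\<open>coord_word_eval_creation\<close>), so coefficients of a series can be read
  off as coordinates.

  Let \<open>F\<close> and \<open>G\<close> be the given map and its inverse. The coefficients of length \<open>m \<ge> 2\<close> vanish by
  strong induction on \<open>m\<close> (\<open>top_coefficients_zero\<close>). The constant coefficients vanish because
  \<open>F 0 = 0\<close>. When the shorter nonlinear coefficients are zero too,
  \<open>F = A + Q\<close> on raising tuples, where \<open>A\<close> is linear and \<open>Q\<close> collects the words of length \<open>m\<close>. For \<open>\<omega>\<close> with \<open>\<omega> ^ (m - 1) = - 1\<close> the rotated map \<open>S T = \<omega>\<^sup>-\<^sup>1 F (\<omega> T)\<close> is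
  \<open>A - Q\<close>. It differs from \<open>F\<close> by \<open>- 2 Q\<close>, which raises the degree by \<open>m\<close>; multiplying it with
  a further raising operator gives zero, so only the linear part \<open>B\<close> of \<open>G\<close> sees it and
  \<open>G (S T) = T - 2 B (Q T)\<close>. For the same reason \<open>Q\<close> does not change when \<open>T\<close> is altered in
  the top degree. Iterating from the creation tuple \<open>L\<close> therefore gives \<open>L - 2 k B (Q L)\<close> after \<open>k\<close>
  steps. All these tuples lie in the domain, whose elements are bounded in norm because the
  coefficients \<open>a [j]\<close> are positive; hence \<open>B (Q L) = 0\<close> and \<open>G (S L) = L\<close>. Applying
  \<open>F\<close> gives \<open>S L = F L\<close>, so \<open>Q L = 0\<close>, and the coefficients of length \<open>m\<close> are zero.
\<close>

section \<open>Operators, words and the norm topology\<close>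

context complex_inner_product_space
begin

lemma ip_minus: "\<lbrakk>x \<in> carrier H; y \<in> carrier H; z \<in> carrier H\<rbrakk> \<Longrightarrow>
    ip H (x \<ominus> y) z = ip H x z - ip H y z"
  using ip_smult[of y z "-1"] by (simp add: a_minus_def ip_add minus_eq_smult)

lemma ip_eq_hnorm: "x \<in> carrier H \<Longrightarrow> ip H x x = of_real ((hnorm H x)\<^sup>2)"
  using ip_self[of x] by (simp add: hnorm_sq)

lemma ip_right_ext:
  assumes y: "y \<in> carrier H" and z: "z \<in> carrier H"
    and eq: "\<And>x. x \<in> carrier H \<Longrightarrow> ip H x y = ip H x z"
  shows "y = z"
proof -
  have "ip H (y \<ominus> z) (y \<ominus> z) = cnj (ip H (y \<ominus> z) y - ip H (y \<ominus> z) z)"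
    using y z by (subst ip_minus) (simp_all add: ip_cnj[of "y \<ominus> z"])
  then have "hnorm H (y \<ominus> z) = 0"
    using eq[of "y \<ominus> z"] y z by (simp add: hnorm_def)
  then show ?thesis
    using y z by (simp add: hnorm_eq_0 M_minus_eq)
qed

lemma hnorm_le_opnorm:
  assumes T: "T \<in> bounded_operators H" and x: "x \<in> carrier H"
  shows "hnorm H (T x) \<le> opnorm H T * hnorm H x"
proof (cases "x = \<zero>")
  case True
  then show ?thesis
    using op_bound[OF T] x hnorm_eq_0[of \<zero>] by (metis mult_zero_right M.zero_closed)
next
  case False
  then have n: "hnorm H x > 0" using hnorm_eq_0[OF x] hnorm_nonneg[OF x] by simp
  define c where "c = complex_of_real (1 / hnorm H x)"
  have "hnorm H (c \<odot> x) = 1" using n x by (simp add: hnorm_smult c_def norm_divide)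
  then have "hnorm H (c \<odot> T x) \<le> opnorm H T"
    using opnorm_bound[OF T, of "c \<odot> x"] x op_smult[OF T x] by simp
  then show ?thesis
    using n op_closed[OF T x] by (simp add: hnorm_smult c_def norm_divide field_simps)
qed

lemma ip_finsum_op:
  assumes "finite A" "\<And>\<alpha>. \<alpha> \<in> A \<Longrightarrow> f \<alpha> \<in> bounded_operators H"
    and x: "x \<in> carrier H" and y: "y \<in> carrier H"
  shows "ip H ((\<Oplus>\<^bsub>op_algebra H\<^esub>\<alpha>\<in>A. f \<alpha>) x) y = (\<Sum>\<alpha>\<in>A. ip H (f \<alpha> x) y)"
  using assms(1,2)
proof (induction rule: finite_induct)
  case empty
  then show ?case using x y by (simp add: op_simps ip_zero_left)
next
  case (insert \<alpha> A)
  have "(\<Oplus>\<^bsub>op_algebra H\<^esub>\<alpha>\<in>A. f \<alpha>) \<in> bounded_operators H"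
    using op.finsum_closed[of f A] insert.prems by (auto simp: op_simps)
  then show ?case
    using insert x y by (simp add: Pi_def op_simps ip_add op_closed)
qed

lemma smult_algebra_op: "T \<in> bounded_operators H \<Longrightarrow> c \<odot>\<^bsub>op_algebra H\<^esub> T \<in> bounded_operators H"
  by (simp add: op_simps smult_op)

lemma smult_algebra_apply: "x \<in> carrier H \<Longrightarrow> (c \<odot>\<^bsub>op_algebra H\<^esub> T) x = c \<odot> T x"
  by (simp add: op_simps)

lemma smult_algebra_inverse:
  assumes T: "T \<in> bounded_operators H" and cd: "c * d = 1"
  shows "c \<odot>\<^bsub>op_algebra H\<^esub> (d \<odot>\<^bsub>op_algebra H\<^esub> T) = T"
  using T cd smult_assoc1[simplified, of _ c d] smult_one[simplified]
  by (intro op_eqI) (auto simp: smult_algebra_op smult_algebra_apply op_closed)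

lemma opdist_smult:
  assumes S: "S \<in> bounded_operators H" and T: "T \<in> bounded_operators H" and c: "cmod c = 1"
  shows "opdist H (c \<odot>\<^bsub>op_algebra H\<^esub> S) (c \<odot>\<^bsub>op_algebra H\<^esub> T) = opdist H S T"
proof -
  have "hnorm H ((c \<odot>\<^bsub>op_algebra H\<^esub> S \<ominus>\<^bsub>op_algebra H\<^esub> c \<odot>\<^bsub>op_algebra H\<^esub> T) x) =
      hnorm H ((S \<ominus>\<^bsub>op_algebra H\<^esub> T) x)" if x: "x \<in> carrier H" for x
  proof -
    have "c \<odot> S x \<ominus> c \<odot> T x = c \<odot> (S x \<ominus> T x)"
      using S T x smult_assoc1[of c "-1" "T x"] smult_assoc1[of "-1" c "T x"]
      by (simp add: a_minus_def minus_eq_smult smult_r_distr op_closed)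
    then show ?thesis
      using S T x c by (simp add: op_minus smult_algebra_op smult_algebra_apply hnorm_smult op_closed)
  qed
  then show ?thesis
    using S T by (simp add: opdist_def smult_algebra_op opnorm_def cong: SUP_cong_simp)
qed

lemma word_eval_Nil: "word_eval (op_algebra H) T [] = (\<lambda>x\<in>carrier H. x)"
  by (simp add: word_eval_def op_simps)

lemma word_eval_Cons:
  "word_eval (op_algebra H) T (i # \<alpha>) = compose (carrier H) (T i) (word_eval (op_algebra H) T \<alpha>)"
  by (simp add: word_eval_def op_simps)

lemma word_eval_op:
  "(\<And>j. T j \<in> bounded_operators H) \<Longrightarrow> word_eval (op_algebra H) T \<alpha> \<in> bounded_operators H"
  by (induction \<alpha>) (simp_all add: word_eval_Nil word_eval_Cons one_op comp_op)

lemma word_eval_Cons_apply: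
  "x \<in> carrier H \<Longrightarrow>
    word_eval (op_algebra H) T (i # \<alpha>) x = T i (word_eval (op_algebra H) T \<alpha> x)"
  by (simp add: word_eval_Cons compose_eq)

lemma word_eval_smult:
  assumes T: "\<And>j. T j \<in> bounded_operators H" and x: "x \<in> carrier H"
  shows "word_eval (op_algebra H) (\<lambda>j. c \<odot>\<^bsub>op_algebra H\<^esub> T j) \<alpha> x =
    c ^ length \<alpha> \<odot> word_eval (op_algebra H) T \<alpha> x"
proof (induction \<alpha>)
  case Nil
  then show ?case using x smult_one[OF x] by (simp add: word_eval_Nil)
next
  case (Cons i \<alpha>)
  have "word_eval (op_algebra H) T \<alpha> x \<in> carrier H"
    using op_closed[OF word_eval_op[OF T] x] .
  then show ?case
    using x Cons T smult_assoc1[of c "c ^ length \<alpha>"]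
    by (simp add: word_eval_Cons_apply smult_algebra_apply op_smult op_closed)
qed

lemma hnorm_word_eval_le:
  assumes T: "\<And>j. T j \<in> bounded_operators H" and x: "x \<in> carrier H" and K: "0 \<le> K"
    and le: "\<And>j y. y \<in> carrier H \<Longrightarrow> hnorm H (T j y) \<le> K * hnorm H y"
  shows "hnorm H (word_eval (op_algebra H) T \<alpha> x) \<le> K ^ length \<alpha> * hnorm H x"
proof (induction \<alpha>)
  case Nil
  then show ?case using x by (simp add: word_eval_Nil)
next
  case (Cons i \<alpha>)
  have "hnorm H (word_eval (op_algebra H) T (i # \<alpha>) x) \<le> K * hnorm H (word_eval (op_algebra H) T \<alpha> x)"
    using x le[OF op_closed[OF word_eval_op[OF T] x]] by (simp add: word_eval_Cons_apply)
  also have "\<dots> \<le> K * (K ^ length \<alpha> * hnorm H x)"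
    using Cons K by (rule mult_left_mono)
  finally show ?case by (simp add: mult.assoc)
qed

text \<open>
  As the index type is finite, a box of balls is a neighbourhood in the product topology, and
  interior points can be recognised by a single radius.
\<close>
lemma free_domain_interior_iff:
  fixes a :: "'n::finite list \<Rightarrow> real"
  shows "T \<in> free_domain_interior a H \<longleftrightarrow> (\<forall>j. T j \<in> bounded_operators H) \<and>
    (\<exists>\<epsilon>>0. \<forall>S. (\<forall>j. S j \<in> bounded_operators H \<and> opdist H (T j) (S j) < \<epsilon>) \<longrightarrow> S \<in> free_domain a H)"
    (is "?L \<longleftrightarrow> ?R")
proof -
  interpret op_ms: Metric_space "bounded_operators H" "opdist H" by (rule Metric_space_opdist)
  let ?X = "product_topology (\<lambda>_::'n. op_topology H) UNIV"
  show ?thesis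
  proof
    assume ?L
    then obtain U where U: "openin ?X U" "T \<in> U" "U \<subseteq> free_domain a H"
      by (auto simp: free_domain_interior_def interior_of_def)
    then obtain B where B: "\<And>j. openin (op_topology H) (B j)" "T \<in> PiE UNIV B" "PiE UNIV B \<subseteq> U"
      using U(1)[unfolded openin_product_topology_alt, rule_format, OF U(2)] by auto
    have "\<exists>\<epsilon>>0. op_ms.mball (T j) \<epsilon> \<subseteq> B j" for j
    proof -
      have "T j \<in> B j" using B(2) by (simp add: PiE_iff)
      then show ?thesis
        using B(1)[of j] unfolding op_topology_def op_ms.openin_mtopology by meson
    qed
    then obtain \<epsilon> where \<epsilon>: "\<And>j. \<epsilon> j > 0" "\<And>j. op_ms.mball (T j) (\<epsilon> j) \<subseteq> B j" by metis
    have T: "\<forall>j. T j \<in> bounded_operators H" using U by (auto simp: free_domain_def)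
    have "S \<in> free_domain a H"
      if S: "\<forall>j. S j \<in> bounded_operators H \<and> opdist H (T j) (S j) < Min (range \<epsilon>)" for S
    proof -
      have "S j \<in> B j" for j
        using S T \<epsilon>(2)[of j] by (auto simp: op_ms.in_mball)
      then have "S \<in> PiE UNIV B" by (auto simp: PiE_iff)
      then show ?thesis using B(3) U(3) by blast
    qed
    moreover have "Min (range \<epsilon>) > 0" using \<epsilon>(1) by (subst Min_gr_iff) auto
    ultimately show ?R using T by (intro conjI exI[of _ "Min (range \<epsilon>)"]) auto
  next
    assume R: ?R
    then obtain \<epsilon> where \<epsilon>: "\<epsilon> > 0"
      "\<And>S. (\<And>j. S j \<in> bounded_operators H \<and> opdist H (T j) (S j) < \<epsilon>) \<Longrightarrow> S \<in> free_domain a H"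
      by blast
    let ?U = "PiE UNIV (\<lambda>j. op_ms.mball (T j) \<epsilon>)"
    have "openin ?X ?U"
      by (auto simp: openin_PiE_gen op_topology_def)
    moreover have "T \<in> ?U" using R \<epsilon>(1) by (auto simp: PiE_iff)
    moreover have "?U \<subseteq> free_domain a H"
      using \<epsilon>(2) by (auto simp: PiE_iff op_ms.in_mball)
    ultimately show ?L
      unfolding free_domain_interior_def interior_of_def by (intro CollectI exI[of _ ?U] conjI)
  qed
qed

lemma free_domain_interior_op: "T \<in> free_domain_interior a H \<Longrightarrow> T j \<in> bounded_operators H"
  by (simp add: free_domain_interior_iff)

lemma free_domain_interior_subset: "free_domain_interior a H \<subseteq> free_domain a H"
  unfolding free_domain_interior_def by (rule interior_of_subset)

end

section \<open>Adjoints and the quadratic form of the domain\<close>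

text \<open>
  Every Hilbert space has adjoints by the Riesz representation theorem. Taking their existence as
  the assumption keeps that theorem out: on the finite-dimensional spaces to which the results are
  applied an adjoint can be written down in coordinates.
\<close>
locale adjointable_space = complex_inner_product_space +
  assumes adjoint_exists: "\<lbrakk>T \<in> bounded_operators H; y \<in> carrier H\<rbrakk> \<Longrightarrow>
    \<exists>z\<in>carrier H. \<forall>x\<in>carrier H. ip H (T x) y = ip H x z"

context adjointable_space
begin

lemma adjoint_props:
  assumes T: "T \<in> bounded_operators H" and y: "y \<in> carrier H"
  shows "adjoint H T y \<in> carrier H \<and> (\<forall>x\<in>carrier H. ip H (T x) y = ip H x (adjoint H T y))"
proof -
  obtain z where z: "z \<in> carrier H \<and> (\<forall>x\<in>carrier H. ip H (T x) y = ip H x z)"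
    using adjoint_exists[OF T y] by blast
  have "z' = z" if "z' \<in> carrier H \<and> (\<forall>x\<in>carrier H. ip H (T x) y = ip H x z')" for z'
    using that z by (intro ip_right_ext) auto
  then have "adjoint H T y = z"
    unfolding adjoint_def using y z by (simp add: the_equality)
  then show ?thesis using z by simp
qed

lemma adjoint_closed: "\<lbrakk>T \<in> bounded_operators H; y \<in> carrier H\<rbrakk> \<Longrightarrow> adjoint H T y \<in> carrier H"
  using adjoint_props by blast

lemma ip_adjoint:
  "\<lbrakk>T \<in> bounded_operators H; x \<in> carrier H; y \<in> carrier H\<rbrakk> \<Longrightarrow>
    ip H (T x) y = ip H x (adjoint H T y)"
  using adjoint_props by blast

lemma adjoint_eqI:
  assumes "T \<in> bounded_operators H" "y \<in> carrier H" "z \<in> carrier H"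
    and "\<And>x. x \<in> carrier H \<Longrightarrow> ip H (T x) y = ip H x z"
  shows "adjoint H T y = z"
proof (rule ip_right_ext[OF adjoint_closed[OF assms(1,2)] assms(3)])
  fix x assume "x \<in> carrier H"
  then show "ip H x (adjoint H T y) = ip H x z"
    using assms(4) ip_adjoint[OF assms(1) _ assms(2)] by simp
qed

lemma hnorm_adjoint_le:
  assumes T: "T \<in> bounded_operators H" and y: "y \<in> carrier H" and K: "0 \<le> K"
    and le: "\<And>x. x \<in> carrier H \<Longrightarrow> hnorm H (T x) \<le> K * hnorm H x"
  shows "hnorm H (adjoint H T y) \<le> K * hnorm H y"
proof (cases "hnorm H (adjoint H T y) = 0")
  case True
  then show ?thesis using K hnorm_nonneg[OF y] by simp
next
  case False
  let ?z = "adjoint H T y"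
  have z: "?z \<in> carrier H" using adjoint_closed[OF T y] .
  have "(hnorm H ?z)\<^sup>2 = cmod (ip H (T ?z) y)"
    using ip_adjoint[OF T z y] ip_eq_hnorm[OF z] by (simp add: norm_power hnorm_nonneg[OF z])
  also have "\<dots> \<le> hnorm H (T ?z) * hnorm H y"
    using Cauchy_Schwarz[OF op_closed[OF T z] y] .
  also have "\<dots> \<le> (K * hnorm H ?z) * hnorm H y"
    using le[OF z] hnorm_nonneg[OF y] by (rule mult_right_mono)
  finally have "hnorm H ?z * hnorm H ?z \<le> hnorm H ?z * (K * hnorm H y)"
    by (simp add: power2_eq_square mult_ac)
  then show ?thesis using False hnorm_nonneg[OF z] by simp
qed

lemma adjoint_op:
  assumes T: "T \<in> bounded_operators H"
  shows "adjoint H T \<in> bounded_operators H"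
proof -
  obtain K where K: "K \<ge> 0" "\<And>x. x \<in> carrier H \<Longrightarrow> hnorm H (T x) \<le> K * hnorm H x"
    using op_bound[OF T] by metis
  have "\<exists>K. \<forall>x\<in>carrier H. hnorm H (adjoint H T x) \<le> K * hnorm H x"
    using hnorm_adjoint_le[OF T _ K] by blast
  moreover have "adjoint H T (x \<oplus> y) = adjoint H T x \<oplus> adjoint H T y"
    if "x \<in> carrier H" "y \<in> carrier H" for x y
    using that T by (intro adjoint_eqI) (simp_all add: adjoint_closed ip_add_right op_closed flip: ip_adjoint)
  moreover have "adjoint H T (c \<odot> x) = c \<odot> adjoint H T x" if "x \<in> carrier H" for c x
    using that T by (intro adjoint_eqI) (simp_all add: adjoint_closed ip_smult_right op_closed flip: ip_adjoint)
  moreover have "adjoint H T \<in> carrier H \<rightarrow>\<^sub>E carrier H"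
    using T by (auto simp: adjoint_closed) (simp add: adjoint_def)
  ultimately show ?thesis unfolding bounded_operators_def by blast
qed

text \<open>
  The operator inequality is tested on vectors, where \<open>T\<^sub>\<alpha> T\<^sub>\<alpha>\<^sup>*\<close> becomes a squared norm. In this form
  the domain is governed by real inequalities only.
\<close>
lemma free_domain_iff:
  fixes a :: "'n::finite list \<Rightarrow> real"
  assumes T: "\<And>j. T j \<in> bounded_operators H"
  shows "T \<in> free_domain a H \<longleftrightarrow> (\<forall>A. finite A \<longrightarrow> (\<forall>x\<in>carrier H.
    (\<Sum>\<alpha>\<in>A. a \<alpha> * (hnorm H (adjoint H (word_eval (op_algebra H) T \<alpha>) x))\<^sup>2) \<le> (hnorm H x)\<^sup>2))"
proof -
  let ?W = "word_eval (op_algebra H) T"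
  let ?t = "\<lambda>\<alpha>. complex_of_real (a \<alpha>) \<odot>\<^bsub>op_algebra H\<^esub> (?W \<alpha> \<otimes>\<^bsub>op_algebra H\<^esub> adjoint H (?W \<alpha>))"
  have W: "?W \<alpha> \<in> bounded_operators H" for \<alpha> using T by (rule word_eval_op)
  have t: "?t \<alpha> \<in> bounded_operators H" for \<alpha>
    using comp_op[OF W adjoint_op[OF W]] by (simp add: smult_op op_simps)
  have "ip H ((\<one>\<^bsub>op_algebra H\<^esub> \<ominus>\<^bsub>op_algebra H\<^esub> (\<Oplus>\<^bsub>op_algebra H\<^esub>\<alpha>\<in>A. ?t \<alpha>)) x) x =
      of_real ((hnorm H x)\<^sup>2 - (\<Sum>\<alpha>\<in>A. a \<alpha> * (hnorm H (adjoint H (?W \<alpha>) x))\<^sup>2))"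
    if A: "finite A" and x: "x \<in> carrier H" for A x
  proof -
    have s: "(\<Oplus>\<^bsub>op_algebra H\<^esub>\<alpha>\<in>A. ?t \<alpha>) \<in> bounded_operators H"
      using op.finsum_closed[of ?t A] t by (auto simp: op_simps(1))
    have o: "\<one>\<^bsub>op_algebra H\<^esub> \<in> bounded_operators H" by (simp add: op_simps one_op)
    have "ip H (?t \<alpha> x) x = of_real (a \<alpha> * (hnorm H (adjoint H (?W \<alpha>) x))\<^sup>2)" for \<alpha>
    proof -
      have z: "adjoint H (?W \<alpha>) x \<in> carrier H" using adjoint_closed[OF W x] .
      then have "?t \<alpha> x = complex_of_real (a \<alpha>) \<odot> ?W \<alpha> (adjoint H (?W \<alpha>) x)"
        using x by (simp add: op_simps compose_eq)
      then show ?thesis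
        using z x by (simp add: ip_smult op_closed[OF W] ip_adjoint[OF W] ip_eq_hnorm)
    qed
    then have "ip H ((\<Oplus>\<^bsub>op_algebra H\<^esub>\<alpha>\<in>A. ?t \<alpha>) x) x =
        of_real (\<Sum>\<alpha>\<in>A. a \<alpha> * (hnorm H (adjoint H (?W \<alpha>) x))\<^sup>2)"
      using ip_finsum_op[OF A t x x] by simp
    moreover have "\<one>\<^bsub>op_algebra H\<^esub> x = x" using x by (simp add: op_simps)
    ultimately show ?thesis
      using x op_closed[OF s x] by (simp add: op_minus[OF o s x] ip_minus ip_eq_hnorm)
  qed
  then show ?thesis
    unfolding free_domain_def op_le_def using T by (auto simp del: of_real_diff)
qed

text \<open>
  The single summand of the word \<open>[j]\<close> already bounds the adjoint of \<open>T j\<close>; passing to the adjoint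
  once more bounds \<open>T j\<close> itself. So the domain is bounded.
\<close>
lemma free_domain_norm_bound:
  assumes T: "T \<in> free_domain a H" and a: "a [j] > 0" and x: "x \<in> carrier H"
  shows "hnorm H (T j x) \<le> sqrt (1 / a [j]) * hnorm H x"
proof -
  have b: "T j \<in> bounded_operators H" for j using T by (auto simp: free_domain_def)
  have w: "word_eval (op_algebra H) T [j] = T j"
    using b[of j] by (intro op_eqI word_eval_op b) (simp_all add: word_eval_Cons_apply word_eval_Nil)
  let ?K = "sqrt (1 / a [j])"
  have le: "hnorm H (adjoint H (T j) y) \<le> ?K * hnorm H y" if y: "y \<in> carrier H" for y
  proof -
    have "a [j] * (hnorm H (adjoint H (T j) y))\<^sup>2 \<le> (hnorm H y)\<^sup>2"
      using T[unfolded free_domain_iff[OF b], rule_format, of "{[j]}" y] y w by simp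
    then have "(hnorm H (adjoint H (T j) y))\<^sup>2 \<le> (?K * hnorm H y)\<^sup>2"
      using a by (simp add: power_mult_distrib field_simps)
    then show ?thesis
      by (rule power2_le_imp_le) (use a hnorm_nonneg[OF y] in simp)
  qed
  have "adjoint H (adjoint H (T j)) x = T j x"
  proof (rule adjoint_eqI[OF adjoint_op[OF b] x op_closed[OF b x]])
    fix y assume y: "y \<in> carrier H"
    show "ip H (adjoint H (T j) y) x = ip H y (T j x)"
      using ip_cnj[OF op_closed[OF b x] y] ip_cnj[OF x adjoint_closed[OF b y]] ip_adjoint[OF b x y]
      by simp
  qed
  then show ?thesis
    using hnorm_adjoint_le[OF adjoint_op[OF b] x _ le] a by simp
qed

lemma adjoint_smult:
  assumes S: "S \<in> bounded_operators H" and T: "T \<in> bounded_operators H" and y: "y \<in> carrier H"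
    and eq: "\<And>x. x \<in> carrier H \<Longrightarrow> S x = c \<odot> T x"
  shows "adjoint H S y = cnj c \<odot> adjoint H T y"
  using assms by (intro adjoint_eqI)
    (simp_all add: adjoint_closed ip_smult ip_smult_right op_closed flip: ip_adjoint)

text \<open>
  The domain is circular: a unimodular factor turns into a unimodular factor of each \<open>T\<^sub>\<alpha>\<^sup>*\<close>, which the
  norms do not see.
\<close>
lemma free_domain_rotate:
  fixes a :: "'n::finite list \<Rightarrow> real"
  assumes T: "T \<in> free_domain a H" and c: "cmod c = 1"
  shows "(\<lambda>j. c \<odot>\<^bsub>op_algebra H\<^esub> T j) \<in> free_domain a H"
proof -
  have b: "T j \<in> bounded_operators H" for j using T by (auto simp: free_domain_def)
  have cb: "c \<odot>\<^bsub>op_algebra H\<^esub> T j \<in> bounded_operators H" for j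
    using b by (rule smult_algebra_op)
  have "hnorm H (adjoint H (word_eval (op_algebra H) (\<lambda>j. c \<odot>\<^bsub>op_algebra H\<^esub> T j) \<alpha>) x) =
      hnorm H (adjoint H (word_eval (op_algebra H) T \<alpha>) x)" if x: "x \<in> carrier H" for \<alpha> x
  proof -
    have W: "word_eval (op_algebra H) T \<alpha> \<in> bounded_operators H" using b by (rule word_eval_op)
    have "adjoint H (word_eval (op_algebra H) (\<lambda>j. c \<odot>\<^bsub>op_algebra H\<^esub> T j) \<alpha>) x =
        cnj (c ^ length \<alpha>) \<odot> adjoint H (word_eval (op_algebra H) T \<alpha>) x"
      by (rule adjoint_smult[OF word_eval_op[OF cb] W x]) (rule word_eval_smult[OF b])
    then show ?thesis
      using adjoint_closed[OF W x] c by (simp add: hnorm_smult norm_power)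
  qed
  then show ?thesis
    using T by (simp add: free_domain_iff[OF b] free_domain_iff[OF cb])
qed

lemma free_domain_interior_rotate:
  fixes a :: "'n::finite list \<Rightarrow> real"
  assumes T: "T \<in> free_domain_interior a H" and c: "cmod c = 1"
  shows "(\<lambda>j. c \<odot>\<^bsub>op_algebra H\<^esub> T j) \<in> free_domain_interior a H"
proof -
  have b: "T j \<in> bounded_operators H" for j using T by (rule free_domain_interior_op)
  obtain \<epsilon> where \<epsilon>: "\<epsilon> > 0"
    "\<And>S. (\<And>j. S j \<in> bounded_operators H \<and> opdist H (T j) (S j) < \<epsilon>) \<Longrightarrow> S \<in> free_domain a H"
    using T unfolding free_domain_interior_iff by blast
  have cc: "c * cnj c = 1" "cnj c * c = 1" using c by (auto simp: complex_norm_square[symmetric] mult.commute)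
  have "S \<in> free_domain a H"
    if S: "\<forall>j. S j \<in> bounded_operators H \<and> opdist H (c \<odot>\<^bsub>op_algebra H\<^esub> T j) (S j) < \<epsilon>" for S
  proof -
    let ?S' = "\<lambda>j. cnj c \<odot>\<^bsub>op_algebra H\<^esub> S j"
    have eq: "c \<odot>\<^bsub>op_algebra H\<^esub> ?S' j = S j" for j
      using S cc by (intro smult_algebra_inverse) auto
    have S': "?S' j \<in> bounded_operators H" for j using S by (simp add: smult_algebra_op)
    have "opdist H (T j) (?S' j) < \<epsilon>" for j
      using spec[OF S, of j] opdist_smult[OF b S' c, of j j] eq by simp
    then have "?S' \<in> free_domain a H" using S' by (intro \<epsilon>(2)) auto
    from free_domain_rotate[OF this c] show ?thesis by (simp add: eq)
  qed
  then show ?thesis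
    unfolding free_domain_interior_iff using \<epsilon>(1) b smult_algebra_op by (intro conjI allI exI[of _ \<epsilon>]) auto
qed

end

text \<open>
  The root condition gives \<open>a \<alpha> \<le> L ^ length \<alpha>\<close> for some \<open>L \<ge> 1\<close>. There are \<open>n ^ k\<close> words of
  length \<open>k\<close>, so \<open>\<rho>\<^sup>2 = 1 / (2 n L)\<close> makes the part of length \<open>k\<close> at most \<open>(1/2) ^ k\<close>, and as
  \<open>a [] = 0\<close> the total is at most \<open>1/2 + 1/4 + \<dots> = 1\<close>.
\<close>
lemma regular_positive_summable:
  fixes a :: "'n::finite list \<Rightarrow> real"
  assumes "regular_positive a"
  obtains \<rho> where "\<rho> > 0" "\<And>A. finite A \<Longrightarrow> (\<Sum>\<alpha>\<in>A. a \<alpha> * \<rho> ^ (2 * length \<alpha>)) \<le> 1"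
proof -
  let ?n = "real CARD('n)"
  have a0: "a [] = 0" and nonneg: "\<And>\<alpha>. a \<alpha> \<ge> 0"
    using assms by (auto simp: regular_positive_def)
  obtain M where M: "\<And>k. k \<ge> 1 \<Longrightarrow> root k \<bar>\<Sum>\<alpha> | length \<alpha> = k. (a \<alpha>)\<^sup>2\<bar> \<le> M"
    using assms unfolding regular_positive_def bdd_above_def by fastforce
  define L where "L = max 1 M"
  have L: "L \<ge> 1" by (simp add: L_def)
  have aL: "a \<alpha> \<le> L ^ length \<alpha>" for \<alpha>
  proof (cases "length \<alpha> = 0")
    case True
    then show ?thesis using a0 by simp
  next
    case False
    let ?k = "length \<alpha>" and ?s = "\<Sum>\<beta> | length \<beta> = length \<alpha>. (a \<beta>)\<^sup>2"
    have fin: "finite {\<beta>::'n list. length \<beta> = ?k}"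
      using finite_lists_length_eq[of "UNIV::'n set" ?k] by simp
    have s: "?s \<ge> 0" by (intro sum_nonneg) simp
    have "(a \<alpha>)\<^sup>2 \<le> ?s"
      using fin by (intro member_le_sum) auto
    also have "\<dots> = root ?k ?s ^ ?k" using False s by simp
    also have "\<dots> \<le> L ^ ?k"
      using M[of ?k] False s by (intro power_mono) (auto simp: L_def)
    \<comment> \<open>The square root is avoided by squaring the bound; this is where \<open>L \<ge> 1\<close> is used.\<close>
    also have "\<dots> \<le> (L ^ ?k)\<^sup>2" using L by (simp add: power2_eq_square)
    finally show ?thesis by (rule power2_le_imp_le) (use L in simp)
  qed
  define \<rho> where "\<rho> = sqrt (1 / (2 * ?n * L))"
  have n: "?n \<ge> 1" by (simp add: Suc_leI)
  have pos: "2 * ?n * L > 0" using n L by simp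
  have \<rho>: "\<rho> > 0" "\<rho>\<^sup>2 = 1 / (2 * ?n * L)" using pos by (simp_all add: \<rho>_def)
  have layer: "(\<Sum>\<alpha> | length \<alpha> = k. a \<alpha> * \<rho> ^ (2 * length \<alpha>)) \<le> (1/2) ^ k" for k
  proof -
    have "(\<Sum>\<alpha> | length \<alpha> = k. a \<alpha> * \<rho> ^ (2 * length \<alpha>)) \<le>
        (\<Sum>\<alpha>::'n list | length \<alpha> = k. L ^ k * (\<rho>\<^sup>2) ^ k)"
      using aL by (intro sum_mono) (auto simp: power_mult intro!: mult_right_mono)
    also have "\<dots> = (?n * L * \<rho>\<^sup>2) ^ k"
      using card_lists_length_eq[of "UNIV::'n set" k] by (simp add: power_mult_distrib)
    also have "?n * L * \<rho>\<^sup>2 = 1/2"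
      using n L by (simp add: \<rho>(2) field_simps)
    finally show ?thesis .
  qed
  have "(\<Sum>\<alpha>\<in>A. a \<alpha> * \<rho> ^ (2 * length \<alpha>)) \<le> 1" if A: "finite A" for A
  proof -
    define K where "K = Max (insert 0 (length ` A))"
    have sub: "A - {[]} \<subseteq> (\<Union>k\<in>{1..K}. {\<alpha>. length \<alpha> = k})"
      using A by (auto simp: K_def Suc_le_eq)
    have fin: "finite {\<alpha>::'n list. length \<alpha> = k}" for k
      using finite_lists_length_eq[of "UNIV::'n set" k] by simp
    have "(\<Sum>\<alpha>\<in>A. a \<alpha> * \<rho> ^ (2 * length \<alpha>)) = (\<Sum>\<alpha>\<in>A - {[]}. a \<alpha> * \<rho> ^ (2 * length \<alpha>))"
      using A a0 by (intro sum.mono_neutral_right) auto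
    also have "\<dots> \<le> (\<Sum>\<alpha>\<in>(\<Union>k\<in>{1..K}. {\<alpha>. length \<alpha> = k}). a \<alpha> * \<rho> ^ (2 * length \<alpha>))"
      using fin sub nonneg \<rho>(1) by (intro sum_mono2) auto
    also have "\<dots> = (\<Sum>k=1..K. \<Sum>\<alpha> | length \<alpha> = k. a \<alpha> * \<rho> ^ (2 * length \<alpha>))"
      using fin by (intro sum.UNION_disjoint) auto
    also have "\<dots> \<le> (\<Sum>k=1..K. (1/2) ^ k)"
      by (intro sum_mono layer)
    also have "\<dots> \<le> 1"
      by (subst sum_gp) auto
    finally show ?thesis .
  qed
  then show thesis using that \<rho>(1) by blast
qed

context adjointable_space
begin

text \<open>
  The radius of the ball inside the domain is halved so that a ball of the same radius around each
  of its points stays inside as well.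
\<close>
lemma small_in_free_domain_interior:
  fixes a :: "'n::finite list \<Rightarrow> real"
  assumes "regular_positive a"
  obtains r where "r > 0" "\<And>T. (\<And>j. T j \<in> bounded_operators H) \<Longrightarrow>
    (\<And>j x. x \<in> carrier H \<Longrightarrow> hnorm H (T j x) \<le> r * hnorm H x) \<Longrightarrow> T \<in> free_domain_interior a H"
proof -
  obtain \<rho> where \<rho>: "\<rho> > 0" "\<And>A. finite A \<Longrightarrow> (\<Sum>\<alpha>\<in>A. a \<alpha> * \<rho> ^ (2 * length \<alpha>)) \<le> 1"
    using regular_positive_summable[OF assms] by blast
  have nonneg: "\<And>\<alpha>. a \<alpha> \<ge> 0" using assms by (auto simp: regular_positive_def)
  have dom: "S \<in> free_domain a H"
    if S: "\<And>j. S j \<in> bounded_operators H"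
      and le: "\<And>j x. x \<in> carrier H \<Longrightarrow> hnorm H (S j x) \<le> \<rho> * hnorm H x" for S
    unfolding free_domain_iff[OF S]
  proof (intro allI impI ballI)
    fix A :: "'n list set" and x assume A: "finite A" and x: "x \<in> carrier H"
    have "hnorm H (adjoint H (word_eval (op_algebra H) S \<alpha>) x) \<le> \<rho> ^ length \<alpha> * hnorm H x" for \<alpha>
      using \<rho>(1) by (intro hnorm_adjoint_le word_eval_op hnorm_word_eval_le S le x) auto
    then have "(hnorm H (adjoint H (word_eval (op_algebra H) S \<alpha>) x))\<^sup>2 \<le> (\<rho> ^ length \<alpha> * hnorm H x)\<^sup>2" for \<alpha>
      by (intro power_mono hnorm_nonneg adjoint_closed word_eval_op S x) auto
    then have "(\<Sum>\<alpha>\<in>A. a \<alpha> * (hnorm H (adjoint H (word_eval (op_algebra H) S \<alpha>) x))\<^sup>2) \<le>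
        (\<Sum>\<alpha>\<in>A. a \<alpha> * (\<rho> ^ length \<alpha> * hnorm H x)\<^sup>2)"
      using nonneg by (intro sum_mono mult_left_mono) auto
    also have "\<dots> = (\<Sum>\<alpha>\<in>A. a \<alpha> * \<rho> ^ (2 * length \<alpha>)) * (hnorm H x)\<^sup>2"
      by (simp add: sum_distrib_right power_mult_distrib power_even_eq mult.assoc)
    also have "\<dots> \<le> 1 * (hnorm H x)\<^sup>2"
      using \<rho>(2)[OF A] by (intro mult_right_mono) auto
    finally show "(\<Sum>\<alpha>\<in>A. a \<alpha> * (hnorm H (adjoint H (word_eval (op_algebra H) S \<alpha>) x))\<^sup>2) \<le> (hnorm H x)\<^sup>2"
      by simp
  qed
  have "T \<in> free_domain_interior a H"
    if T: "\<And>j. T j \<in> bounded_operators H"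
      and le: "\<And>j x. x \<in> carrier H \<Longrightarrow> hnorm H (T j x) \<le> \<rho> / 2 * hnorm H x" for T
  proof -
    have "S \<in> free_domain a H"
      if S: "\<forall>j. S j \<in> bounded_operators H \<and> opdist H (T j) (S j) < \<rho> / 2" for S
    proof (rule dom)
      fix j show Sj: "S j \<in> bounded_operators H" using S by blast
      fix x assume x: "x \<in> carrier H"
      have D: "S j \<ominus>\<^bsub>op_algebra H\<^esub> T j \<in> bounded_operators H"
        using op.minus_closed[of "S j" "T j"] Sj T[of j] by (simp add: op_simps(1))
      have "opnorm H (S j \<ominus>\<^bsub>op_algebra H\<^esub> T j) \<le> \<rho> / 2"
        using spec[OF S, of j] Sj T[of j] Metric_space.commute[OF Metric_space_opdist, of "S j" "T j"]
        by (simp add: opdist_def)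
      then have "hnorm H (S j x \<ominus> T j x) \<le> \<rho> / 2 * hnorm H x"
        using hnorm_le_opnorm[OF D x] op_minus[OF Sj T x] mult_right_mono[OF _ hnorm_nonneg[OF x]]
        by (fastforce intro: order_trans)
      moreover have "S j x = (S j x \<ominus> T j x) \<oplus> T j x"
        using op_closed[OF Sj x] op_closed[OF T x]
        by (simp add: a_minus_def M.a_assoc M.l_neg)
      then have "hnorm H (S j x) \<le> hnorm H (S j x \<ominus> T j x) + hnorm H (T j x)"
        using hnorm_add[of "S j x \<ominus> T j x" "T j x"] op_closed[OF Sj x] op_closed[OF T x] by simp
      ultimately show "hnorm H (S j x) \<le> \<rho> * hnorm H x"
        using le[OF x, of j] by simp
    qed
    then show ?thesis
      unfolding free_domain_interior_iff using T \<rho>(1) by (intro conjI allI exI[of _ "\<rho> / 2"]) auto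
  qed
  then show thesis using that[of "\<rho> / 2"] \<rho>(1) by simp
qed

end


section \<open>Truncated Fock spaces\<close>

text \<open>
  The vectors are functions on words that vanish beyond length \<open>m\<close>, transported into the
  universe \<open>'h\<close> along an injection \<open>e\<close>; \<open>inv_into UNIV e\<close> recovers the coordinates.
\<close>
definition fock :: "(('n list \<Rightarrow> complex) \<Rightarrow> 'h) \<Rightarrow> nat \<Rightarrow> 'h hilbert"
  where "fock e m =
    \<lparr> carrier = e ` {f. \<forall>\<alpha>. m < length \<alpha> \<longrightarrow> f \<alpha> = 0},
      mult = (\<lambda>x y. x),
      one = e (\<lambda>_. 0),
      zero = e (\<lambda>_. 0),
      add = (\<lambda>x y. e (\<lambda>\<alpha>. inv_into UNIV e x \<alpha> + inv_into UNIV e y \<alpha>)),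
      smult = (\<lambda>c x. e (\<lambda>\<alpha>. c * inv_into UNIV e x \<alpha>)),
      ip = (\<lambda>x y. \<Sum>\<alpha> | length \<alpha> \<le> m. inv_into UNIV e x \<alpha> * cnj (inv_into UNIV e y \<alpha>)) \<rparr>"

locale truncated_fock =
  fixes e :: "('n::finite list \<Rightarrow> complex) \<Rightarrow> 'h" and m :: nat
  assumes inj: "inj e"
begin

abbreviation H :: "'h hilbert" where "H \<equiv> fock e m"
abbreviation coord :: "'h \<Rightarrow> 'n list \<Rightarrow> complex" where "coord \<equiv> inv_into UNIV e"

lemma finite_words: "finite {\<alpha>::'n list. length \<alpha> \<le> m}"
  using finite_lists_length_le[of "UNIV::'n set" m] by simp

lemma coord_e [simp]: "coord (e f) = f"
  using inj by (rule inv_f_f)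

lemma fock_simps:
  "x \<in> carrier H \<longleftrightarrow> x \<in> range e \<and> (\<forall>\<alpha>. m < length \<alpha> \<longrightarrow> coord x \<alpha> = 0)"
  "\<zero>\<^bsub>H\<^esub> = e (\<lambda>_. 0)"
  "x \<oplus>\<^bsub>H\<^esub> y = e (\<lambda>\<alpha>. coord x \<alpha> + coord y \<alpha>)"
  "c \<odot>\<^bsub>H\<^esub> x = e (\<lambda>\<alpha>. c * coord x \<alpha>)"
  "ip H x y = (\<Sum>\<alpha> | length \<alpha> \<le> m. coord x \<alpha> * cnj (coord y \<alpha>))"
  by (auto simp: fock_def)

lemma e_closed: "e f \<in> carrier H \<longleftrightarrow> (\<forall>\<alpha>. m < length \<alpha> \<longrightarrow> f \<alpha> = 0)"
  by (auto simp: fock_simps(1))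

lemma e_coord: "x \<in> carrier H \<Longrightarrow> e (coord x) = x"
  by (auto simp: fock_simps(1))

lemma coord_outside: "x \<in> carrier H \<Longrightarrow> m < length \<alpha> \<Longrightarrow> coord x \<alpha> = 0"
  by (simp add: fock_simps(1))

lemma coord_ext:
  assumes "x \<in> carrier H" "y \<in> carrier H" and "\<And>\<alpha>. length \<alpha> \<le> m \<Longrightarrow> coord x \<alpha> = coord y \<alpha>"
  shows "x = y"
proof -
  have "coord x = coord y"
  proof
    fix \<alpha> show "coord x \<alpha> = coord y \<alpha>"
      using assms by (cases "length \<alpha> \<le> m") (auto simp: coord_outside)
  qed
  then show ?thesis using assms(1,2) e_coord by metis
qed

lemma ip_self_eq: "ip H x x = of_real (\<Sum>\<alpha> | length \<alpha> \<le> m. (cmod (coord x \<alpha>))\<^sup>2)"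
  unfolding fock_simps by (simp only: complex_norm_square[symmetric] of_real_sum)

lemma complex_inner_product_space_fock: "complex_inner_product_space H"
proof (intro complex_inner_product_space.intro complex_inner_product_space_axioms.intro moduleI
    cring_from_type_algebra abelian_groupI)
  fix x assume x: "x \<in> carrier H"
  show "\<exists>y\<in>carrier H. y \<oplus>\<^bsub>H\<^esub> x = \<zero>\<^bsub>H\<^esub>"
    using x by (intro bexI[of _ "e (\<lambda>\<alpha>. - coord x \<alpha>)"])
      (auto simp: e_closed coord_outside fock_simps(2,3))
  show "Re (ip H x x) > 0" if nz: "x \<noteq> \<zero>\<^bsub>H\<^esub>"
  proof -
    have "\<exists>\<alpha>. length \<alpha> \<le> m \<and> coord x \<alpha> \<noteq> 0"
      using nz coord_ext[of x "\<zero>\<^bsub>H\<^esub>"] x by (auto simp: e_closed fock_simps(2))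
    then show ?thesis
      unfolding ip_self_eq using finite_words by (auto intro!: sum_pos2)
  qed
qed (auto simp: e_closed coord_outside fock_simps(2-5) e_coord algebra_simps sum.distrib
    sum_distrib_left)

sublocale complex_inner_product_space H
  by (rule complex_inner_product_space_fock)

lemma coord_add: "coord (x \<oplus>\<^bsub>H\<^esub> y) \<alpha> = coord x \<alpha> + coord y \<alpha>"
  and coord_smult: "coord (c \<odot>\<^bsub>H\<^esub> x) \<alpha> = c * coord x \<alpha>"
  and coord_zero: "coord \<zero>\<^bsub>H\<^esub> \<alpha> = 0"
  by (simp_all add: fock_simps(2-4))

lemma hnorm_fock: "hnorm H x = sqrt (\<Sum>\<alpha> | length \<alpha> \<le> m. (cmod (coord x \<alpha>))\<^sup>2)"
  by (simp add: hnorm_def ip_self_eq)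

lemma coord_le_hnorm: "x \<in> carrier H \<Longrightarrow> cmod (coord x \<alpha>) \<le> hnorm H x"
proof (cases "length \<alpha> \<le> m")
  case True
  then have "(cmod (coord x \<alpha>))\<^sup>2 \<le> (\<Sum>\<alpha> | length \<alpha> \<le> m. (cmod (coord x \<alpha>))\<^sup>2)"
    using finite_words by (intro member_le_sum) auto
  then show ?thesis unfolding hnorm_fock by (rule real_le_rsqrt)
next
  case False
  then show "x \<in> carrier H \<Longrightarrow> ?thesis" by (simp add: coord_outside hnorm_nonneg)
qed

lemma coord_minus: "\<lbrakk>x \<in> carrier H; y \<in> carrier H\<rbrakk> \<Longrightarrow> coord (x \<ominus>\<^bsub>H\<^esub> y) \<alpha> = coord x \<alpha> - coord y \<alpha>"
  by (simp add: a_minus_def minus_eq_smult coord_add coord_smult)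

lemma mcomplete_fock: "Metric_space.mcomplete (carrier H) (hdist H)"
proof -
  interpret M: Metric_space "carrier H" "hdist H" by (rule Metric_space_hdist)
  show ?thesis
    unfolding M.mcomplete_def
  proof (intro allI impI)
    fix \<sigma> assume "M.MCauchy \<sigma>"
    then have \<sigma>: "\<And>n. \<sigma> n \<in> carrier H"
      and C: "\<And>\<epsilon>. \<epsilon> > 0 \<Longrightarrow> \<exists>N. \<forall>n n'. N \<le> n \<longrightarrow> N \<le> n' \<longrightarrow> hdist H (\<sigma> n) (\<sigma> n') < \<epsilon>"
      unfolding M.MCauchy_def by auto
    have "Cauchy (\<lambda>n. coord (\<sigma> n) \<alpha>)" for \<alpha>
    proof (rule metric_CauchyI)
      fix \<epsilon> :: real assume "\<epsilon> > 0"
      then obtain N where N: "\<forall>n n'. N \<le> n \<longrightarrow> N \<le> n' \<longrightarrow> hdist H (\<sigma> n) (\<sigma> n') < \<epsilon>"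
        using C by blast
      have "dist (coord (\<sigma> n) \<alpha>) (coord (\<sigma> n') \<alpha>) \<le> hdist H (\<sigma> n) (\<sigma> n')" for n n'
        using coord_le_hnorm[of "\<sigma> n \<ominus>\<^bsub>H\<^esub> \<sigma> n'" \<alpha>] \<sigma>
        by (simp add: hdist_def coord_minus dist_norm)
      then show "\<exists>N. \<forall>n\<ge>N. \<forall>n'\<ge>N. dist (coord (\<sigma> n) \<alpha>) (coord (\<sigma> n') \<alpha>) < \<epsilon>"
        using N by (meson le_less_trans)
    qed
    then have "\<exists>l. (\<lambda>n. coord (\<sigma> n) \<alpha>) \<longlonglongrightarrow> l" for \<alpha>
      using Cauchy_convergent convergent_def by blast
    then obtain l where l: "\<And>\<alpha>. (\<lambda>n. coord (\<sigma> n) \<alpha>) \<longlonglongrightarrow> l \<alpha>" by metis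
    have "l \<alpha> = 0" if "m < length \<alpha>" for \<alpha>
      using l[of \<alpha>] coord_outside[OF \<sigma> that] by (simp add: LIMSEQ_const_iff)
    then have el: "e l \<in> carrier H" by (simp add: e_closed)
    have "(\<lambda>n. sqrt (\<Sum>\<alpha> | length \<alpha> \<le> m. (cmod (coord (\<sigma> n) \<alpha> - l \<alpha>))\<^sup>2)) \<longlonglongrightarrow>
        sqrt (\<Sum>\<alpha>::'n list | length \<alpha> \<le> m. (cmod (l \<alpha> - l \<alpha>))\<^sup>2)"
      by (intro tendsto_intros l)
    then have "(\<lambda>n. hdist H (\<sigma> n) (e l)) \<longlonglongrightarrow> 0"
      using \<sigma> el by (simp add: hdist_def hnorm_fock coord_minus)
    then have "limitin M.mtopology \<sigma> (e l) sequentially"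
      using \<sigma> el by (simp add: M.limitin_metric_dist_null)
    then show "\<exists>x. limitin M.mtopology \<sigma> x sequentially" by blast
  qed
qed

lemma hilbert_space_fock: "hilbert_space H"
  by (intro hilbert_space.intro hilbert_space_axioms.intro complex_inner_product_space_fock
      mcomplete_fock)

sublocale hilbert_space H
  by (rule hilbert_space_fock)

definition basis :: "'n list \<Rightarrow> 'h" where "basis \<alpha> = e (\<lambda>\<beta>. if \<beta> = \<alpha> then 1 else 0)"

lemma basis_closed: "length \<alpha> \<le> m \<Longrightarrow> basis \<alpha> \<in> carrier H"
  by (auto simp: basis_def e_closed)

lemma coord_basis: "coord (basis \<alpha>) \<beta> = (if \<beta> = \<alpha> then 1 else 0)"
  by (simp add: basis_def)

text \<open>
  Expansion of a vector in the basis, tested against \<open>y\<close>. The statement is about an arbitrary finite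
  set of words supporting the vector so that it can be proved by induction on that set.
\<close>
lemma ip_op_expansion:
  assumes A: "finite A" "A \<subseteq> {\<alpha>. length \<alpha> \<le> m}" and T: "T \<in> bounded_operators H"
    and y: "y \<in> carrier H" and f: "\<And>\<alpha>. \<alpha> \<notin> A \<Longrightarrow> f \<alpha> = 0"
  shows "ip H (T (e f)) y = (\<Sum>\<alpha>\<in>A. f \<alpha> * ip H (T (basis \<alpha>)) y)"
  using A f
proof (induction A arbitrary: f rule: finite_induct)
  case empty
  then have "f = (\<lambda>_. 0)" by auto
  then have "e f = \<zero>\<^bsub>H\<^esub>" by (simp add: fock_simps(2))
  moreover have "T \<zero>\<^bsub>H\<^esub> = \<zero>\<^bsub>H\<^esub>"
    using op_smult[OF T M.zero_closed, of 0] by (simp add: fock_simps(2,4))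
  ultimately show ?case
    using y by (simp add: ip_zero_left)
next
  case (insert \<alpha> A)
  let ?g = "f(\<alpha> := 0)"
  have b: "basis \<alpha> \<in> carrier H" using insert.prems by (intro basis_closed) auto
  have g: "e ?g \<in> carrier H"
    unfolding e_closed using insert.prems by (metis fun_upd_apply insertE linorder_not_less mem_Collect_eq subsetD)
  have ef: "e f = f \<alpha> \<odot>\<^bsub>H\<^esub> basis \<alpha> \<oplus>\<^bsub>H\<^esub> e ?g"
    by (simp add: fock_simps(3,4) coord_basis) (rule arg_cong[of _ _ e], auto)
  have "ip H (T (e f)) y = f \<alpha> * ip H (T (basis \<alpha>)) y + ip H (T (e ?g)) y"
    unfolding ef using b g y op_closed[OF T] by (simp add: op_add[OF T] op_smult[OF T] ip_add ip_smult)
  also have "ip H (T (e ?g)) y = (\<Sum>\<beta>\<in>A. ?g \<beta> * ip H (T (basis \<beta>)) y)"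
    using insert.prems insert.hyps by (intro insert.IH) auto
  also have "\<dots> = (\<Sum>\<beta>\<in>A. f \<beta> * ip H (T (basis \<beta>)) y)"
    using insert.hyps by (intro sum.cong) auto
  finally show ?case using insert.hyps by simp
qed

sublocale adjointable_space H
proof
  fix T y assume T: "T \<in> bounded_operators H" and y: "y \<in> carrier H"
  let ?z = "e (\<lambda>\<alpha>. if length \<alpha> \<le> m then cnj (ip H (T (basis \<alpha>)) y) else 0)"
  have "ip H (T x) y = ip H x ?z" if x: "x \<in> carrier H" for x
  proof -
    have "ip H (T (e (coord x))) y = (\<Sum>\<alpha> | length \<alpha> \<le> m. coord x \<alpha> * ip H (T (basis \<alpha>)) y)"
      using finite_words T y x by (intro ip_op_expansion) (auto simp: coord_outside)
    also have "\<dots> = ip H x ?z"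
      unfolding fock_simps(5)[of x] by (intro sum.cong) auto
    finally show ?thesis by (simp add: e_coord[OF x])
  qed
  moreover have "?z \<in> carrier H" by (simp add: e_closed)
  ultimately show "\<exists>z\<in>carrier H. \<forall>x\<in>carrier H. ip H (T x) y = ip H x z" by blast
qed

lemma op_ext_coord:
  assumes "S \<in> bounded_operators H" "T \<in> bounded_operators H"
    and "\<And>x \<beta>. \<lbrakk>x \<in> carrier H; length \<beta> \<le> m\<rbrakk> \<Longrightarrow> coord (S x) \<beta> = coord (T x) \<beta>"
  shows "S = T"
  using assms by (intro op_eqI coord_ext) (auto simp: op_closed)

lemma coord_finsum_op:
  assumes "finite A" "\<And>\<alpha>. \<alpha> \<in> A \<Longrightarrow> f \<alpha> \<in> bounded_operators H" and x: "x \<in> carrier H"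
  shows "coord ((\<Oplus>\<^bsub>op_algebra H\<^esub>\<alpha>\<in>A. f \<alpha>) x) \<beta> = (\<Sum>\<alpha>\<in>A. coord (f \<alpha> x) \<beta>)"
  using assms(1,2)
proof (induction rule: finite_induct)
  case empty
  then show ?case using x by (simp add: op_simps coord_zero)
next
  case (insert \<alpha> A)
  then show ?case
    using x by (simp add: Pi_def op_simps(1) op_simps(5) coord_add)
qed


section \<open>Operators that raise the degree\<close>

text \<open>
  The filtration by degree starts with the whole space and satisfies \<open>deg_ge (m + 1) = {0}\<close>; this is
  what makes raising operators nilpotent.
\<close>
definition deg_ge :: "nat \<Rightarrow> 'h set"
  where "deg_ge i = {x \<in> carrier H. \<forall>\<alpha>. length \<alpha> < i \<longrightarrow> coord x \<alpha> = 0}"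

definition raising :: "nat \<Rightarrow> ('h \<Rightarrow> 'h) set"
  where "raising k = {T \<in> bounded_operators H. \<forall>i. \<forall>x\<in>deg_ge i. T x \<in> deg_ge (i + k)}"

lemma raising_op: "T \<in> raising k \<Longrightarrow> T \<in> bounded_operators H"
  by (simp add: raising_def)

lemma raising_apply: "\<lbrakk>T \<in> raising k; x \<in> deg_ge i\<rbrakk> \<Longrightarrow> T x \<in> deg_ge (i + k)"
  by (simp add: raising_def)

lemma deg_ge_0: "deg_ge 0 = carrier H"
  by (simp add: deg_ge_def)

lemma raisingI:
  assumes "T \<in> bounded_operators H"
    and "\<And>x i \<beta>. \<lbrakk>x \<in> deg_ge i; length \<beta> < i + k\<rbrakk> \<Longrightarrow> coord (T x) \<beta> = 0"
  shows "T \<in> raising k"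
  using assms by (auto simp: raising_def deg_ge_def op_closed)

lemma word_eval_raising:
  assumes T: "\<And>j. T j \<in> raising 1"
  shows "word_eval (op_algebra H) T \<alpha> \<in> raising (length \<alpha>)"
proof (induction \<alpha>)
  case Nil
  then show ?case
    unfolding word_eval_Nil by (intro raisingI one_op) (auto simp: deg_ge_def)
next
  case (Cons j \<alpha>)
  have W: "word_eval (op_algebra H) T (j # \<alpha>) \<in> bounded_operators H"
    using T raising_op by (intro word_eval_op) blast
  moreover have "word_eval (op_algebra H) T (j # \<alpha>) x \<in> deg_ge (i + length (j # \<alpha>))"
    if x: "x \<in> deg_ge i" for i x
  proof -
    have "x \<in> carrier H" using x by (simp add: deg_ge_def)
    then show ?thesis
      using raising_apply[OF T raising_apply[OF Cons x]] by (simp add: word_eval_Cons_apply)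
  qed
  ultimately show ?case by (simp add: raising_def)
qed

lemma coord_word_eval_eq_0:
  assumes T: "\<And>j. T j \<in> raising 1" and x: "x \<in> deg_ge i" and \<beta>: "length \<beta> < i + length \<alpha>"
  shows "coord (word_eval (op_algebra H) T \<alpha> x) \<beta> = 0"
  using raising_apply[OF word_eval_raising[where T = T, OF T, of \<alpha>] x] \<beta> by (auto simp: deg_ge_def)

text \<open>
  For tuples of bounded operators this says that each difference \<open>T j - T' j\<close> belongs to
  \<open>raising m\<close>. In coordinates no difference of operators has to be formed.
\<close>
definition agree_modulo_top :: "('n \<Rightarrow> 'h \<Rightarrow> 'h) \<Rightarrow> ('n \<Rightarrow> 'h \<Rightarrow> 'h) \<Rightarrow> bool"
  where "agree_modulo_top T T' \<longleftrightarrow> (\<forall>j i. \<forall>x\<in>deg_ge i. \<forall>\<beta>. length \<beta> < i + m \<longrightarrow>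
    coord (T j x) \<beta> = coord (T' j x) \<beta>)"

text \<open>
  Expand a word in \<open>T = T' + Z\<close>, where \<open>Z\<close> raises the degree by \<open>m\<close>. Every term other than the word
  in \<open>T'\<close> contains a factor from \<open>Z\<close> and at least one further raising factor, so it raises the degree
  by at least \<open>m + 1\<close> and vanishes.
\<close>
lemma agree_modulo_top_word_eval:
  assumes T: "\<And>j. T j \<in> raising 1" and T': "\<And>j. T' j \<in> raising 1" and eq: "agree_modulo_top T T'"
    and \<alpha>: "2 \<le> length \<alpha>" and x: "x \<in> carrier H"
  shows "word_eval (op_algebra H) T \<alpha> x = word_eval (op_algebra H) T' \<alpha> x"
proof -
  let ?W = "word_eval (op_algebra H) T" and ?W' = "word_eval (op_algebra H) T'"
  have b: "T j \<in> bounded_operators H" "T' j \<in> bounded_operators H" for j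
    using T T' raising_op by blast+
  have W: "?W \<beta> x \<in> carrier H" "?W' \<beta> x \<in> carrier H" for \<beta>
    using x op_closed word_eval_op b by metis+
  \<comment> \<open>The last letter to act: \<open>y\<close> has positive degree, where \<open>T j\<close> and \<open>T' j\<close> agree in all
  coordinates, and a change of \<open>y\<close> in degree \<open>m\<close> is sent to degree \<open>m + 1\<close>, that is to zero.\<close>
  have step: "T j y = T' j z"
    if y: "y \<in> deg_ge 1" and z: "z \<in> carrier H"
      and yz: "\<And>\<beta>. length \<beta> < m \<Longrightarrow> coord y \<beta> = coord z \<beta>" for j y z
  proof -
    have yc: "y \<in> carrier H" using y by (simp add: deg_ge_def)
    have "T j y = T' j y"
      using eq[unfolded agree_modulo_top_def] y yc b by (intro coord_ext) (auto simp: op_closed)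
    also have "\<dots> = T' j z"
    proof (rule coord_ext)
      have "y \<ominus>\<^bsub>H\<^esub> z \<in> deg_ge m"
        using yc z yz by (simp add: deg_ge_def coord_minus)
      then have "T' j (y \<ominus>\<^bsub>H\<^esub> z) \<in> deg_ge (m + 1)" by (rule raising_apply[OF T'])
      moreover have "T' j y = T' j (y \<ominus>\<^bsub>H\<^esub> z) \<oplus>\<^bsub>H\<^esub> T' j z"
      proof -
        have "y = (y \<ominus>\<^bsub>H\<^esub> z) \<oplus>\<^bsub>H\<^esub> z" using yc z by (simp add: a_minus_def M.a_assoc M.l_neg)
        then show ?thesis using op_add[OF b(2), of "y \<ominus>\<^bsub>H\<^esub> z" z] yc z by simp
      qed
      ultimately show "coord (T' j y) \<beta> = coord (T' j z) \<beta>" if "length \<beta> \<le> m" for \<beta>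
        using that by (simp add: deg_ge_def coord_add)
    qed (use b yc z in \<open>auto simp: op_closed\<close>)
    finally show ?thesis .
  qed
  have "?W \<beta> x \<in> deg_ge 1" if "\<beta> \<noteq> []" for \<beta>
    using raising_apply[OF word_eval_raising[where T = T, OF T, of \<beta>], of x 0] x that
    by (cases \<beta>) (auto simp: deg_ge_def)
  moreover have "\<forall>\<gamma>. length \<gamma> < m \<longrightarrow> coord (?W \<beta> x) \<gamma> = coord (?W' \<beta> x) \<gamma>" if "\<beta> \<noteq> []" for \<beta>
    using that
  proof (induction \<beta>)
    case (Cons j \<beta>)
    show ?case
    proof (cases "\<beta> = []")
      case True
      then show ?thesis
        using eq[unfolded agree_modulo_top_def, rule_format, of x 0 _ j] x
        by (simp add: word_eval_Cons_apply word_eval_Nil deg_ge_0)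
    next
      case False
      then have "T j (?W \<beta> x) = T' j (?W' \<beta> x)"
        using Cons.IH W calculation by (intro step) auto
      then show ?thesis using x by (simp add: word_eval_Cons_apply)
    qed
  qed simp
  moreover obtain j \<beta> where "\<alpha> = j # \<beta>" "\<beta> \<noteq> []"
    using \<alpha> by (cases \<alpha>) (auto simp: Suc_le_eq)
  ultimately show ?thesis
    using step[of "?W \<beta> x" "?W' \<beta> x" j] W x by (simp add: word_eval_Cons_apply)
qed


section \<open>Power series at nilpotent tuples\<close>

text \<open>
  The partial sum over the words of length at most \<open>m\<close>; at a tuple of raising operators the longer
  words contribute nothing and this is the sum of the series.
\<close>
definition series :: "('n list \<Rightarrow> complex) \<Rightarrow> ('n \<Rightarrow> 'h \<Rightarrow> 'h) \<Rightarrow> ('h \<Rightarrow> 'h)"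
  where "series c T = (\<Oplus>\<^bsub>op_algebra H\<^esub>k\<in>{..<Suc m}. \<Oplus>\<^bsub>op_algebra H\<^esub>\<alpha>\<in>{\<alpha>. length \<alpha> = k}.
    c \<alpha> \<odot>\<^bsub>op_algebra H\<^esub> word_eval (op_algebra H) T \<alpha>)"

lemma series_sums_nilpotent:
  assumes T: "\<And>j. T j \<in> raising 1"
  shows "series_sums H c T (series c T)"
    and series_op: "series c T \<in> bounded_operators H"
    and coord_series: "x \<in> carrier H \<Longrightarrow> coord (series c T x) \<beta> =
      (\<Sum>\<alpha> | length \<alpha> \<le> m. c \<alpha> * coord (word_eval (op_algebra H) T \<alpha> x) \<beta>)"
proof -
  interpret op_ms: Metric_space "bounded_operators H" "opdist H" by (rule Metric_space_opdist)
  let ?t = "\<lambda>\<alpha>. c \<alpha> \<odot>\<^bsub>op_algebra H\<^esub> word_eval (op_algebra H) T \<alpha>"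
  let ?L = "\<lambda>k. \<Oplus>\<^bsub>op_algebra H\<^esub>\<alpha>\<in>{\<alpha>. length \<alpha> = k}. ?t \<alpha>"
  let ?P = "\<lambda>N. \<Oplus>\<^bsub>op_algebra H\<^esub>k\<in>{..<N}. ?L k"
  have b: "T j \<in> bounded_operators H" for j using T raising_op by blast
  have t: "?t \<alpha> \<in> bounded_operators H" for \<alpha> using b by (intro smult_algebra_op word_eval_op)
  have L: "?L k \<in> bounded_operators H" for k
    using op.finsum_closed[of ?t "{\<alpha>. length \<alpha> = k}"] t by (auto simp: op_simps(1))
  have P: "?P N \<in> bounded_operators H" for N
    using op.finsum_closed[of ?L "{..<N}"] L by (auto simp: op_simps(1))
  have fin: "finite {\<alpha>::'n list. length \<alpha> = k}" for k
    using finite_lists_length_eq[of "UNIV::'n set" k] by simp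
  have coord_P: "coord (?P N x) \<beta> =
      (\<Sum>k<N. \<Sum>\<alpha> | length \<alpha> = k. c \<alpha> * coord (word_eval (op_algebra H) T \<alpha> x) \<beta>)"
    if x: "x \<in> carrier H" for N x \<beta>
    using x by (simp add: coord_finsum_op[OF _ L] coord_finsum_op[OF fin t] smult_algebra_apply coord_smult)
  have const: "?P N = ?P (Suc m)" if N: "N \<ge> Suc m" for N
  proof (rule op_ext_coord[OF P P])
    fix x and \<beta> :: "'n list" assume x: "x \<in> carrier H" and \<beta>: "length \<beta> \<le> m"
    show "coord (?P N x) \<beta> = coord (?P (Suc m) x) \<beta>"
      unfolding coord_P[OF x]
    proof (rule sum.mono_neutral_right)
      show "\<forall>k\<in>{..<N} - {..<Suc m}.
          (\<Sum>\<alpha> | length \<alpha> = k. c \<alpha> * coord (word_eval (op_algebra H) T \<alpha> x) \<beta>) = 0"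
        using coord_word_eval_eq_0[where T = T, OF T, of x 0 \<beta>] x \<beta> by (auto simp: deg_ge_0 intro!: sum.neutral)
    qed (use N in auto)
  qed
  have "eventually (\<lambda>N. ?P N = series c T) sequentially"
    unfolding series_def eventually_sequentially using const by blast
  then show "series_sums H c T (series c T)"
    unfolding series_sums_def op_topology_def
    by (intro limitin_eventually) (auto simp: P series_def)
  show "series c T \<in> bounded_operators H" unfolding series_def by (rule P)
  show "coord (series c T x) \<beta> =
      (\<Sum>\<alpha> | length \<alpha> \<le> m. c \<alpha> * coord (word_eval (op_algebra H) T \<alpha> x) \<beta>)"
    if x: "x \<in> carrier H"
  proof -
    have "{\<alpha>::'n list. length \<alpha> \<le> m} = (\<Union>k<Suc m. {\<alpha>. length \<alpha> = k})" by auto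
    then show ?thesis
      unfolding series_def coord_P[OF x] using fin by (simp only:) (subst sum.UNION_disjoint, auto)
  qed
qed

lemma induced_map_nilpotent:
  assumes T: "\<And>j. T j \<in> raising 1"
  shows "induced_map c H T j = series (c j) T"
  unfolding induced_map_def
  using series_sums_nilpotent(1)[where T = T, OF T] series_sums_unique by (blast intro: the_equality)


section \<open>Creation operators\<close>

definition creation :: "real \<Rightarrow> 'n \<Rightarrow> 'h \<Rightarrow> 'h"
  where "creation r j = (\<lambda>x\<in>carrier H. e (\<lambda>\<alpha>. case \<alpha> of [] \<Rightarrow> 0
    | i # \<beta> \<Rightarrow> if i = j \<and> length \<beta> < m then of_real r * coord x \<beta> else 0))"

lemma coord_creation:
  "x \<in> carrier H \<Longrightarrow> coord (creation r j x) \<alpha> = (case \<alpha> of [] \<Rightarrow> 0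
    | i # \<beta> \<Rightarrow> if i = j \<and> length \<beta> < m then of_real r * coord x \<beta> else 0)"
  by (simp add: creation_def)

lemma creation_closed: "x \<in> carrier H \<Longrightarrow> creation r j x \<in> carrier H"
  by (auto simp: creation_def e_closed split: list.split)

lemma hnorm_creation_le:
  assumes x: "x \<in> carrier H" and r: "0 \<le> r"
  shows "hnorm H (creation r j x) \<le> r * hnorm H x"
proof -
  let ?A = "{\<beta>::'n list. length \<beta> < m}"
  have fin: "finite ?A" by (rule finite_subset[OF _ finite_words]) auto
  have "(\<Sum>\<alpha> | length \<alpha> \<le> m. (cmod (coord (creation r j x) \<alpha>))\<^sup>2) =
      (\<Sum>\<alpha>\<in>(#) j ` ?A. (cmod (coord (creation r j x) \<alpha>))\<^sup>2)"
    using finite_words x by (intro sum.mono_neutral_right) (auto simp: coord_creation split: list.split)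
  \<comment> \<open>Vectors of top degree are annihilated; on the rest \<open>\<beta> \<mapsto> j # \<beta>\<close> is injective.\<close>
  also have "\<dots> = (\<Sum>\<beta>\<in>?A. r\<^sup>2 * (cmod (coord x \<beta>))\<^sup>2)"
    using x by (subst sum.reindex) (auto simp: coord_creation norm_mult power_mult_distrib)
  also have "\<dots> \<le> (\<Sum>\<beta> | length \<beta> \<le> m. r\<^sup>2 * (cmod (coord x \<beta>))\<^sup>2)"
    using finite_words by (intro sum_mono2) auto
  also have "\<dots> = (r * hnorm H x)\<^sup>2"
    by (simp add: hnorm_fock power_mult_distrib sum_distrib_left sum_nonneg)
  finally show ?thesis
    unfolding hnorm_fock[of "creation r j x"] using r hnorm_nonneg[OF x] by (intro real_le_lsqrt) auto
qed

lemma creation_op: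
  assumes r: "0 \<le> r"
  shows "creation r j \<in> bounded_operators H"
proof -
  have "creation r j (x \<oplus>\<^bsub>H\<^esub> y) = creation r j x \<oplus>\<^bsub>H\<^esub> creation r j y"
    if "x \<in> carrier H" "y \<in> carrier H" for x y
    using that by (intro coord_ext)
      (auto simp: creation_closed coord_creation coord_add algebra_simps split: list.split)
  moreover have "creation r j (c \<odot>\<^bsub>H\<^esub> x) = c \<odot>\<^bsub>H\<^esub> creation r j x" if "x \<in> carrier H" for c x
    using that by (intro coord_ext)
      (auto simp: creation_closed coord_creation coord_smult algebra_simps split: list.split)
  moreover have "creation r j \<in> carrier H \<rightarrow>\<^sub>E carrier H"
    using creation_closed by (auto simp: creation_def)
  ultimately show ?thesis
    unfolding bounded_operators_def using hnorm_creation_le[OF _ r] by (auto intro!: exI[of _ r])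
qed

lemma creation_raising: "0 \<le> r \<Longrightarrow> creation r j \<in> raising 1"
  by (intro raisingI creation_op) (auto simp: deg_ge_def coord_creation split: list.split)

text \<open>
  The creation operators spell out a word on the vacuum vector, so distinct words give orthogonal
  vectors. This turns coefficients into coordinates.
\<close>
lemma coord_word_eval_creation:
  assumes r: "0 \<le> r"
  shows "length \<alpha> \<le> m \<Longrightarrow> coord (word_eval (op_algebra H) (creation r) \<alpha> (basis [])) \<beta> =
    (if \<beta> = \<alpha> then of_real r ^ length \<alpha> else 0)"
proof (induction \<alpha> arbitrary: \<beta>)
  case Nil
  then show ?case by (simp add: word_eval_Nil basis_closed coord_basis)
next
  case (Cons j \<alpha>)
  have b: "basis [] \<in> carrier H" by (simp add: basis_closed)
  then have "word_eval (op_algebra H) (creation r) \<alpha> (basis []) \<in> carrier H"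
    using r by (intro op_closed[OF word_eval_op b] creation_op)
  then show ?case
    using Cons b by (auto simp: word_eval_Cons_apply coord_creation split: list.split)
qed

text \<open>
  Only the linear part of a series sees a perturbation in the top degree: by
  \<open>agree_modulo_top_word_eval\<close> the longer words do not change, and the constant term never does.
\<close>
lemma coord_series_difference:
  assumes T: "\<And>j. T j \<in> raising 1" and T': "\<And>j. T' j \<in> raising 1" and eq: "agree_modulo_top T T'"
    and x: "x \<in> carrier H" and m: "1 \<le> m"
  shows "coord (series c T x) \<beta> =
    coord (series c T' x) \<beta> + (\<Sum>i\<in>UNIV. c [i] * (coord (T i x) \<beta> - coord (T' i x) \<beta>))"
proof -
  let ?D = "\<lambda>\<alpha>. coord (word_eval (op_algebra H) T \<alpha> x) \<beta> - coord (word_eval (op_algebra H) T' \<alpha> x) \<beta>"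
  have zero: "?D \<alpha> = 0" if "length \<alpha> \<noteq> 1" for \<alpha>
  proof (cases "\<alpha> = []")
    case True
    then show ?thesis by (simp add: word_eval_Nil)
  next
    case False
    with that have "2 \<le> length \<alpha>" by (cases \<alpha>) (auto simp: Suc_le_eq)
    then show ?thesis using agree_modulo_top_word_eval[OF T T' eq _ x] by simp
  qed
  have "coord (series c T x) \<beta> - coord (series c T' x) \<beta> = (\<Sum>\<alpha> | length \<alpha> \<le> m. c \<alpha> * ?D \<alpha>)"
    by (simp add: coord_series[where T = T, OF T x] coord_series[where T = T', OF T' x]
        sum_subtractf right_diff_distrib)
  also have "\<dots> = (\<Sum>\<alpha>\<in>range (\<lambda>i. [i]). c \<alpha> * ?D \<alpha>)"
  proof (rule sum.mono_neutral_right[OF finite_words])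
    show "\<forall>\<alpha>\<in>{\<alpha>. length \<alpha> \<le> m} - range (\<lambda>i. [i]). c \<alpha> * ?D \<alpha> = 0"
      using zero by (auto simp: length_Suc_conv)
  qed (use m in auto)
  also have "\<dots> = (\<Sum>i\<in>UNIV. c [i] * (coord (T i x) \<beta> - coord (T' i x) \<beta>))"
    using x by (subst sum.reindex) (auto simp: inj_on_def word_eval_Cons_apply word_eval_Nil)
  finally show ?thesis by (simp add: algebra_simps)
qed

text \<open>
  A nonempty word in raising operators moves the vacuum vector to positive degree, so it does not
  contribute to the coordinate at the empty word.
\<close>
lemma coord_series_vacuum:
  assumes T: "\<And>j. T j \<in> raising 1"
  shows "coord (series c T (basis [])) [] = c []"
proof -
  have b: "basis [] \<in> carrier H" by (simp add: basis_closed)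
  have "coord (series c T (basis [])) [] = (\<Sum>\<alpha> | length \<alpha> \<le> m. if \<alpha> = [] then c \<alpha> else 0)"
    unfolding coord_series[where T = T, OF T b]
  proof (intro sum.cong refl)
    fix \<alpha> show "c \<alpha> * coord (word_eval (op_algebra H) T \<alpha> (basis [])) [] = (if \<alpha> = [] then c \<alpha> else 0)"
      using b coord_word_eval_eq_0[where T = T, OF T, of "basis []" 0 "[]" \<alpha>]
      by (auto simp: word_eval_Nil coord_basis deg_ge_0)
  qed
  then show ?thesis using finite_words by simp
qed

lemma series_raising:
  assumes T: "\<And>j. T j \<in> raising 1" and c: "c [] = 0"
  shows "series c T \<in> raising 1"
proof (rule raisingI[OF series_op[where T = T, OF T]])
  fix x i and \<beta> :: "'n list" assume x: "x \<in> deg_ge i" and \<beta>: "length \<beta> < i + 1"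
  have "c \<alpha> * coord (word_eval (op_algebra H) T \<alpha> x) \<beta> = 0" for \<alpha>
    using c coord_word_eval_eq_0[where T = T, OF T x, of \<beta> \<alpha>] \<beta> by (cases \<alpha>) auto
  moreover have "x \<in> carrier H" using x by (simp add: deg_ge_def)
  ultimately show "coord (series c T x) \<beta> = 0"
    by (simp only: coord_series[where T = T, OF T] sum.neutral_const)
qed

lemma smult_raising: "T \<in> raising k \<Longrightarrow> c \<odot>\<^bsub>op_algebra H\<^esub> T \<in> raising k"
  by (auto simp: raising_def smult_algebra_op smult_algebra_apply deg_ge_def coord_smult op_closed)

lemma zero_raising: "\<zero>\<^bsub>op_algebra H\<^esub> \<in> raising k"
  unfolding op_simps by (intro raisingI zero_op) (auto simp: deg_ge_def coord_zero)

lemma constant_coefficient_zero: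
  fixes c :: "'n \<Rightarrow> 'n list \<Rightarrow> complex"
  assumes "induced_map c H (\<lambda>_. \<zero>\<^bsub>op_algebra H\<^esub>) = (\<lambda>_. \<zero>\<^bsub>op_algebra H\<^esub>)"
  shows "c j [] = 0"
proof -
  have "series (c j) (\<lambda>_. \<zero>\<^bsub>op_algebra H\<^esub>) = \<zero>\<^bsub>op_algebra H\<^esub>"
    using induced_map_nilpotent[of "\<lambda>_. \<zero>\<^bsub>op_algebra H\<^esub>" c j] assms zero_raising by simp
  then show ?thesis
    using coord_series_vacuum[of "\<lambda>_. \<zero>\<^bsub>op_algebra H\<^esub>" "c j"] zero_raising
    by (simp add: op_simps(4) basis_closed coord_zero)
qed


section \<open>Cartan's argument\<close>

text \<open>
  In the proof \<open>L\<close> is the creation tuple, \<open>F\<close> and \<open>G\<close> are the two maps on raising tuples,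
  \<open>S T = \<omega>\<^sup>-\<^sup>1 F (\<omega> T)\<close>, and \<open>q\<close> and \<open>w\<close> are the matrix coefficients of \<open>- 2 Q L\<close> and of
  \<open>- 2 B (Q L)\<close> in the notation of the introduction.
\<close>
lemma top_coefficients_zero:
  fixes a :: "'n list \<Rightarrow> real"
  assumes regular: "regular_positive a"
    and c_int: "\<And>T. T \<in> free_domain_interior a H \<Longrightarrow> induced_map c H T \<in> free_domain_interior a H"
    and d_int: "\<And>T. T \<in> free_domain_interior a H \<Longrightarrow> induced_map d H T \<in> free_domain_interior a H"
    and cd: "\<And>T. T \<in> free_domain_interior a H \<Longrightarrow> induced_map c H (induced_map d H T) = T"
    and dc: "\<And>T. T \<in> free_domain_interior a H \<Longrightarrow> induced_map d H (induced_map c H T) = T"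
    and c0: "\<And>j. c j [] = 0"
    and low: "\<And>j \<alpha>. \<lbrakk>2 \<le> length \<alpha>; length \<alpha> < m\<rbrakk> \<Longrightarrow> c j \<alpha> = 0"
    and m: "2 \<le> m" and \<gamma>: "length \<gamma> = m"
  shows "c j \<gamma> = 0"
proof -
  define \<omega> where "\<omega> = cis (pi / real (m - 1))"
  have \<omega>: "cmod \<omega> = 1" "cnj \<omega> * \<omega> = 1"
    by (simp_all add: \<omega>_def cis_cnj cis_mult)
  \<comment> \<open>The factor by which the rotation changes the words of length \<open>m\<close> relative to the linear ones has
  to differ from \<open>1\<close>; the choice \<open>- 1\<close> is the one furthest from it.\<close>
  have "real (m - 1) * (pi / real (m - 1)) = pi" using m by simp
  then have "\<omega> ^ (m - 1) = -1" unfolding \<omega>_def Complex.DeMoivre by (simp only: cis_pi)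
  then have \<omega>m: "cnj \<omega> * \<omega> ^ m = -1"
    using m \<omega>(2) by (cases m) (simp_all add: mult.assoc[symmetric])
  obtain r where r: "r > 0" and small: "\<And>T. (\<And>j. T j \<in> bounded_operators H) \<Longrightarrow>
      (\<And>j x. x \<in> carrier H \<Longrightarrow> hnorm H (T j x) \<le> r * hnorm H x) \<Longrightarrow> T \<in> free_domain_interior a H"
    using small_in_free_domain_interior[OF regular] by blast
  define L where "L = creation r"
  have LE: "L j \<in> raising 1" for j
    unfolding L_def using r by (intro creation_raising) simp
  have LI: "L \<in> free_domain_interior a H"
    using r by (intro small) (auto simp: L_def creation_op hnorm_creation_le)
  define F where "F T = (\<lambda>j. series (c j) T)" for T
  define G where "G T = (\<lambda>j. series (d j) T)" for T
  define S where "S T = (\<lambda>j. cnj \<omega> \<odot>\<^bsub>op_algebra H\<^esub> F (\<lambda>i. \<omega> \<odot>\<^bsub>op_algebra H\<^esub> T i) j)" for T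
  \<comment> \<open>\<open>q\<close> is defined from \<open>L\<close> alone: on words of length \<open>m\<close> any tuple that agrees with \<open>L\<close> modulo
  the top degree takes the same values.\<close>
  define q where "q j x \<beta> = (\<Sum>\<alpha> | length \<alpha> \<le> m. if length \<alpha> = m
    then - 2 * (c j \<alpha> * coord (word_eval (op_algebra H) L \<alpha> x) \<beta>) else 0)" for j x \<beta>
  define w where "w j x \<beta> = (\<Sum>i\<in>UNIV. d j [i] * q i x \<beta>)" for j x \<beta>
  have F: "induced_map c H T = F T" and FE: "F T j \<in> raising 1"
    and G: "induced_map d H T = G T" and Gb: "G T j \<in> bounded_operators H"
    if "\<And>j. T j \<in> raising 1" for T j
  proof -
    show "induced_map c H T = F T" "induced_map d H T = G T"
      unfolding F_def G_def using induced_map_nilpotent[where T = T, OF that] by auto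
    show "F T j \<in> raising 1" unfolding F_def by (intro series_raising that c0)
    show "G T j \<in> bounded_operators H" unfolding G_def by (intro series_op that)
  qed
  have SE: "S T j \<in> raising 1" if "\<And>j. T j \<in> raising 1" for T j
    unfolding S_def using that by (intro smult_raising FE)
  have SI: "S T \<in> free_domain_interior a H"
    if T: "\<And>j. T j \<in> raising 1" and TI: "T \<in> free_domain_interior a H" for T
  proof -
    have "F (\<lambda>i. \<omega> \<odot>\<^bsub>op_algebra H\<^esub> T i) \<in> free_domain_interior a H"
      using c_int[OF free_domain_interior_rotate[OF TI \<omega>(1)]] F[of "\<lambda>i. \<omega> \<odot>\<^bsub>op_algebra H\<^esub> T i"]
        smult_raising[OF T] by simp
    from free_domain_interior_rotate[OF this, of "cnj \<omega>"] show ?thesis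
      using \<omega>(1) by (simp add: S_def)
  qed
  have q_zero: "q j x \<beta> = 0" if "x \<in> deg_ge i" "length \<beta> < i + m" for j x \<beta> i
    unfolding q_def using coord_word_eval_eq_0[where T = L, OF LE that(1)] that(2)
    by (intro sum.neutral) auto
  then have w_zero: "w j x \<beta> = 0" if "x \<in> deg_ge i" "length \<beta> < i + m" for j x \<beta> i
    unfolding w_def using that by (intro sum.neutral) auto
  have coord_S: "coord (S T j x) \<beta> = coord (F T j x) \<beta> + q j x \<beta>"
    if T: "\<And>j. T j \<in> raising 1" and eq: "agree_modulo_top T L" and x: "x \<in> carrier H" for T j x \<beta>
  proof -
    let ?W = "word_eval (op_algebra H) T" and ?\<omega>T = "\<lambda>i. \<omega> \<odot>\<^bsub>op_algebra H\<^esub> T i"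
    have b: "T j \<in> bounded_operators H" for j using T raising_op by blast
    have "coord (S T j x) \<beta> = cnj \<omega> * coord (series (c j) ?\<omega>T x) \<beta>"
      by (simp add: S_def F_def smult_algebra_apply[OF x] coord_smult)
    also have "\<dots> = (\<Sum>\<alpha> | length \<alpha> \<le> m. c j \<alpha> * (cnj \<omega> * \<omega> ^ length \<alpha>) * coord (?W \<alpha> x) \<beta>)"
      using coord_series[where T = ?\<omega>T, OF smult_raising[OF T] x]
      by (simp add: word_eval_smult[where T = T, OF b x] coord_smult sum_distrib_left mult_ac)
    also have "\<dots> = (\<Sum>\<alpha> | length \<alpha> \<le> m. c j \<alpha> * coord (?W \<alpha> x) \<beta> + (if length \<alpha> = m
        then - 2 * (c j \<alpha> * coord (word_eval (op_algebra H) L \<alpha> x) \<beta>) else 0))"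
    proof (intro sum.cong refl)
      fix \<alpha> :: "'n list" assume "\<alpha> \<in> {\<alpha>. length \<alpha> \<le> m}"
      then have "length \<alpha> \<le> m" by simp
      then have "length \<alpha> = 0 \<or> length \<alpha> = 1 \<or> 2 \<le> length \<alpha> \<and> length \<alpha> < m \<or> length \<alpha> = m"
        by linarith
      then consider "\<alpha> = []" | "length \<alpha> = 1" | "2 \<le> length \<alpha>" "length \<alpha> < m" | "length \<alpha> = m"
        by auto
      then show "c j \<alpha> * (cnj \<omega> * \<omega> ^ length \<alpha>) * coord (?W \<alpha> x) \<beta> =
          c j \<alpha> * coord (?W \<alpha> x) \<beta> + (if length \<alpha> = m
            then - 2 * (c j \<alpha> * coord (word_eval (op_algebra H) L \<alpha> x) \<beta>) else 0)"
      proof cases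
        case 4
        then have "?W \<alpha> x = word_eval (op_algebra H) L \<alpha> x"
          using m x by (intro agree_modulo_top_word_eval T LE eq) auto
        then show ?thesis using 4 \<omega>m by simp
      qed (use m c0 low \<omega>(2) in auto)
    qed
    also have "\<dots> = coord (F T j x) \<beta> + q j x \<beta>"
      by (simp add: F_def q_def coord_series[where T = T, OF T x] sum.distrib)
    finally show ?thesis .
  qed
  have coord_GS: "coord (G (S T) j x) \<beta> = coord (T j x) \<beta> + w j x \<beta>"
    if T: "\<And>j. T j \<in> raising 1" and TI: "T \<in> free_domain_interior a H"
      and eq: "agree_modulo_top T L" and x: "x \<in> carrier H" for T j x \<beta>
  proof -
    have "agree_modulo_top (S T) (F T)"
      using coord_S[OF T eq] q_zero by (auto simp: agree_modulo_top_def deg_ge_def)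
    then have "coord (G (S T) j x) \<beta> = coord (G (F T) j x) \<beta> +
        (\<Sum>i\<in>UNIV. d j [i] * (coord (S T i x) \<beta> - coord (F T i x) \<beta>))"
      unfolding G_def using m x by (intro coord_series_difference SE FE T) auto
    moreover have "G (F T) = T" using dc[OF TI] F[OF T] G[OF FE[OF T]] by simp
    ultimately show ?thesis by (simp add: coord_S[OF T eq x] w_def)
  qed
  \<comment> \<open>The \<open>k\<close>-th iterate of \<open>T \<mapsto> G (S T)\<close> at \<open>L\<close>: the correction \<open>w\<close> is the same in every step, so it
  accumulates linearly.\<close>
  have iterate: "\<exists>T. (\<forall>j. T j \<in> raising 1) \<and> T \<in> free_domain_interior a H \<and> agree_modulo_top T L \<and>
      (\<forall>j. \<forall>x\<in>carrier H. \<forall>\<beta>. coord (T j x) \<beta> = coord (L j x) \<beta> + of_nat k * w j x \<beta>)" for k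
  proof (induction k)
    case 0
    then show ?case using LE LI by (intro exI[of _ L]) (auto simp: agree_modulo_top_def)
  next
    case (Suc k)
    then obtain T where T: "\<And>j. T j \<in> raising 1" "T \<in> free_domain_interior a H" "agree_modulo_top T L"
      "\<And>j x \<beta>. x \<in> carrier H \<Longrightarrow> coord (T j x) \<beta> = coord (L j x) \<beta> + of_nat k * w j x \<beta>"
      by blast
    have dc: "x \<in> carrier H" if "x \<in> deg_ge i" for x i using that by (simp add: deg_ge_def)
    have GS: "coord (G (S T) j x) \<beta> = coord (T j x) \<beta> + w j x \<beta>" if "x \<in> carrier H" for j x \<beta>
      using that by (intro coord_GS T)
    have "G (S T) j \<in> raising 1" for j
    proof (rule raisingI[OF Gb[OF SE[OF T(1)]]])
      fix x i and \<beta> :: "'n list" assume x: "x \<in> deg_ge i" and \<beta>: "length \<beta> < i + 1"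
      have "coord (T j x) \<beta> = 0" using raising_apply[OF T(1) x] \<beta> by (simp add: deg_ge_def)
      moreover have "w j x \<beta> = 0" using w_zero[OF x] \<beta> m by simp
      ultimately show "coord (G (S T) j x) \<beta> = 0" using GS[OF dc[OF x]] by simp
    qed
    moreover have "G (S T) \<in> free_domain_interior a H"
      using d_int[OF SI[OF T(1,2)]] G[OF SE[OF T(1)]] by simp
    moreover have "agree_modulo_top (G (S T)) L"
      using T(3) GS[OF dc] w_zero by (auto simp: agree_modulo_top_def)
    ultimately show ?case
      using GS T(4) by (intro exI[of _ "G (S T)"]) (auto simp: algebra_simps)
  qed
  have w0: "w j x \<beta> = 0" if x: "x \<in> carrier H" for j x \<beta>
  proof (rule ccontr)
    assume "w j x \<beta> \<noteq> 0"
    define K where "K = sqrt (1 / a [j]) * hnorm H x"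
    have aj: "a [j] > 0" using regular by (simp add: regular_positive_def)
    \<comment> \<open>Coordinates of the iterates are bounded independently of \<open>k\<close> because the domain is bounded.\<close>
    have bound: "real k * cmod (w j x \<beta>) \<le> 2 * K" for k
    proof -
      obtain T where T: "\<And>j. T j \<in> raising 1" "T \<in> free_domain_interior a H"
        "coord (T j x) \<beta> = coord (L j x) \<beta> + of_nat k * w j x \<beta>"
        using iterate[of k] x by blast
      have le: "cmod (coord (U j x) \<beta>) \<le> K" if "U \<in> free_domain_interior a H" for U
      proof -
        have "hnorm H (U j x) \<le> K"
          unfolding K_def
          by (rule free_domain_norm_bound[where T = U and a = a and j = j, OF _ aj x])
            (rule subsetD[OF free_domain_interior_subset that])
        then show ?thesis
          using coord_le_hnorm[OF op_closed[OF free_domain_interior_op[OF that] x], of j \<beta>] by simp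
      qed
      have "of_nat k * w j x \<beta> = coord (T j x) \<beta> - coord (L j x) \<beta>" using T(3) by simp
      then have "real k * cmod (w j x \<beta>) = cmod (coord (T j x) \<beta> - coord (L j x) \<beta>)"
        by (metis norm_mult norm_of_nat)
      then show ?thesis
        using norm_triangle_ineq4[of "coord (T j x) \<beta>" "coord (L j x) \<beta>"] le[OF T(2)] le[OF LI] by simp
    qed
    obtain k where "2 * K < real k * cmod (w j x \<beta>)"
      using ex_less_of_nat_mult[of "cmod (w j x \<beta>)" "2 * K"] \<open>w j x \<beta> \<noteq> 0\<close> by auto
    then show False using bound[of k] by simp
  qed
  have LL: "agree_modulo_top L L" by (simp add: agree_modulo_top_def)
  \<comment> \<open>That \<open>w\<close> vanishes only shows that the linear part of \<open>G\<close> kills \<open>q\<close>. The vanishing of \<open>q\<close> itself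
  follows by applying \<open>F\<close> to \<open>G (S L) = L\<close>.\<close>
  have "G (S L) j = L j" for j
  proof (rule op_ext_coord[OF _ raising_op[OF LE]])
    show "G (S L) j \<in> bounded_operators H" by (intro Gb SE LE)
    show "coord (G (S L) j x) \<beta> = coord (L j x) \<beta>" if "x \<in> carrier H" for x \<beta>
      using coord_GS[OF LE LI LL that] w0[OF that] by simp
  qed
  then have "G (S L) = L" ..
  then have "F L = S L"
    using cd[OF SI[OF LE LI]] G[of "S L", OF SE[of L, OF LE]] F[of L, OF LE] by simp
  then have "q j (basis []) \<gamma> = 0"
    using coord_S[of L "basis []" j \<gamma>, OF LE LL basis_closed] by simp
  moreover have "q j (basis []) \<gamma> = - 2 * (c j \<gamma> * of_real r ^ m)"
  proof -
    have "q j (basis []) \<gamma> = (\<Sum>\<alpha> | length \<alpha> \<le> m. if \<alpha> = \<gamma> then - 2 * (c j \<gamma> * of_real r ^ m) else 0)"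
      unfolding q_def L_def using r \<gamma> by (intro sum.cong refl) (auto simp: coord_word_eval_creation)
    then show ?thesis using finite_words \<gamma> by simp
  qed
  ultimately show ?thesis using r by simp
qed

end

theorem theorem4p5:
  fixes a :: "'n::finite list \<Rightarrow> real"
    and c :: "'n \<Rightarrow> 'n list \<Rightarrow> complex"
  assumes universe: "(UNIV :: (nat \<Rightarrow> complex) set) \<lesssim> (UNIV :: 'h set)"
    and regular: "regular_positive a"
    and biholomorphic: "biholomorphic_map TYPE('h) a c"
    and zero: "maps_zero_to_zero TYPE('h) c"
  shows "\<forall>j. \<forall>\<alpha>. length \<alpha> \<noteq> 1 \<longrightarrow> c j \<alpha> = 0"
proof -
  obtain g :: "(nat \<Rightarrow> complex) \<Rightarrow> 'h" where g: "inj g"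
    using universe by (auto simp: lepoll_def)
  \<comment> \<open>Words over a finite alphabet are countable, so functions on words embed into sequences.\<close>
  define e :: "('n list \<Rightarrow> complex) \<Rightarrow> 'h" where "e f = g (\<lambda>i. f (from_nat i))" for f
  have "inj e"
  proof (rule injI)
    fix f f' assume "e f = e f'"
    then have "(\<lambda>i. f (from_nat i)) = (\<lambda>i. f' (from_nat i))"
      unfolding e_def using g by (simp add: inj_eq)
    then have "f (from_nat (to_nat \<alpha>)) = f' (from_nat (to_nat \<alpha>))" for \<alpha> :: "'n list" by metis
    then show "f = f'" by (simp add: fun_eq_iff)
  qed
  then have fock: "truncated_fock e" by (simp add: truncated_fock_def)
  have hilbert: "hilbert_space (fock e m)" for m
    by (rule truncated_fock.hilbert_space_fock[OF fock])
  obtain d where "holomorphic_map TYPE('h) a d"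
    and "\<forall>H :: 'h hilbert. hilbert_space H \<longrightarrow> (\<forall>T\<in>free_domain_interior a H.
      induced_map c H (induced_map d H T) = T \<and> induced_map d H (induced_map c H T) = T)"
    and "holomorphic_map TYPE('h) a c"
    using biholomorphic unfolding biholomorphic_map_def by blast
  then have bihol: "induced_map c (fock e m) T \<in> free_domain_interior a (fock e m)"
      "induced_map d (fock e m) T \<in> free_domain_interior a (fock e m)"
      "induced_map c (fock e m) (induced_map d (fock e m) T) = T"
      "induced_map d (fock e m) (induced_map c (fock e m) T) = T"
    if "T \<in> free_domain_interior a (fock e m)" for T m
    using hilbert[of m] that unfolding holomorphic_map_def by blast+
  \<comment> \<open>For \<open>m = 0\<close> the Fock space is one-dimensional, and the zero tuple is mapped to the scalars \<open>c j []\<close>.\<close>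
  have c0: "c j [] = 0" for j
    using zero hilbert[of 0] truncated_fock.constant_coefficient_zero[OF fock, where m = 0 and c = c]
    unfolding maps_zero_to_zero_def by blast
  have high: "2 \<le> m \<longrightarrow> (\<forall>j \<alpha>. length \<alpha> = m \<longrightarrow> c j \<alpha> = 0)" for m
  proof (induction m rule: less_induct)
    case (less m)
    show ?case
    proof (intro impI allI)
      fix j \<alpha> assume m: "2 \<le> m" and \<alpha>: "length (\<alpha> :: 'n list) = m"
      show "c j \<alpha> = 0"
      proof (rule truncated_fock.top_coefficients_zero[OF fock regular, where m = m and d = d])
        show "c j' \<beta> = 0" if "2 \<le> length \<beta>" "length \<beta> < m" for j' \<beta>
          using less.IH that by blast
      qed (fact bihol c0 m \<alpha>)+
    qed
  qed
  show ?thesis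
  proof (intro allI impI)
    fix j and \<alpha> :: "'n list" assume "length \<alpha> \<noteq> 1"
    then show "c j \<alpha> = 0"
      using c0[of j] high[of "length \<alpha>"] by (cases \<alpha>) (auto simp: Suc_le_eq)
  qed
qed

end
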